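(* Consider observations $y_1,\dots,y_n\in\{0,1,2,\dots\}$ modeled as: independently for $i=1,\dots,n$, $y_i\mid\beta,\xi,\eta_i\sim\mathrm{Po}\big(\eta_i\exp(x_i^t\beta+g_i^t\xi_i)\big)$, with $\eta_1,\dots,\eta_n$ i.i.d. with density $f(\eta)=(1-s)\mathrm{Ga}(\eta\mid\alpha,\alpha)+sH(\eta)$ for fixed $s\in(0,1)$ and fixed $\alpha\ge1$, where $H(\eta)=\frac1\pi\frac{\{\log(1+\eta)\}^{-1/2}}{(1+\eta)\{1+\log(1+\eta)\}}$; here $x_i\in\mathbb R^p$, $g_i\in\mathbb R^q$ are fixed covariates, $\beta\in\mathbb R^p$, $\xi=(\xi_1,\dots,\xi_n)$ with $\xi_i\in\mathbb R^q$, and the prior is $\pi(\beta,\xi)=\pi_\beta(\beta)\pi_\xi(\xi)$ with $\pi_\beta$ a probability density on $\mathbb R^p$ and $\pi_\xi$ a (nondegenerate) multivariate normal density. Let $\{1,\dots,n\}=\mathcal K\cup\mathcal L$ be a partition into nonempty sets; $y_i$ is fixed for $i\in\mathcal K$, while $y_i=y_i(\omega)\to\infty$ as $\omega\to\infty$ for every $i\in\mathcal L$. Let $\mathcal K_+=\{i\in\mathcal K: y_i\ge1\}$ and assume $|\mathcal K_+|+1\ge|\mathcal L|+p$, and that any $p$ of the vectors $\{x_i:i\in\mathcal K_+\}$ are linearly independent. Then for every $(\beta,\xi)$, the posterior density satisfies $p(\beta,\xi\mid y)\to p(\beta,\xi\mid y_{\mathcal K})$ as $\omega\to\infty$, where $y=(y_1,\dots,y_n)$,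 $y_{\mathcal K}=(y_i)_{i\in\mathcal K}$, and $p(\beta,\xi\mid y_{\mathcal K})$ is the posterior based only on the observations indexed by $\mathcal K$ (with $\eta_i$ integrated out).
   Context: $\mathrm{Po}(\mu)$ is the Poisson distribution with mean $\mu$. $\mathrm{Ga}(\eta\mid\alpha,\beta)=\beta^\alpha\eta^{\alpha-1}e^{-\beta\eta}/\Gamma(\alpha)$ (shape $\alpha$, rate $\beta$). The posterior density is $p(\beta,\xi\mid y)\propto\pi(\beta,\xi)\prod_{i=1}^n\int_0^\infty f(u)\,\mathrm{Po}(y_i\mid u\exp(x_i^t\beta+g_i^t\xi_i))\,du$, and analogously for $p(\beta,\xi\mid y_{\mathcal K})$ with the product over $i\in\mathcal K$. *)

theory Defs
  imports "HOL-Analysis.Analysis"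
begin

definition gamma_dens :: "real \<Rightarrow> real \<Rightarrow> real \<Rightarrow> real" where
  "gamma_dens a b \<eta> = (if \<eta> > 0 then b powr a * \<eta> powr (a - 1) * exp (- b * \<eta>) / Gamma a else 0)"

definition H_dens :: "real \<Rightarrow> real" where
  "H_dens \<eta> = (if \<eta> > 0 then (1 / pi) * (ln (1 + \<eta>)) powr (- 1 / 2)
                  / ((1 + \<eta>) * (1 + ln (1 + \<eta>))) else 0)"

definition mix_dens :: "real \<Rightarrow> real \<Rightarrow> real \<Rightarrow> real" where
  "mix_dens s \<alpha> \<eta> = (1 - s) * gamma_dens \<alpha> \<alpha> \<eta> + s * H_dens \<eta>"

definition poisson_dens :: "nat \<Rightarrow> real \<Rightarrow> real" where
  "poisson_dens k \<mu> = \<mu> ^ k * exp (- \<mu>) / fact k"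

definition flatten :: "real^'q^'n \<Rightarrow> real^('n \<times> 'q)" where
  "flatten v = (\<chi> ij. v $ fst ij $ snd ij)"

definition pos_def_matrix :: "real^'d^'d \<Rightarrow> bool" where
  "pos_def_matrix S \<longleftrightarrow> transpose S = S \<and> (\<forall>v. v \<noteq> 0 \<longrightarrow> v \<bullet> (S *v v) > 0)"

definition mvn_dens :: "real^'d \<Rightarrow> real^'d^'d \<Rightarrow> real^'d \<Rightarrow> real" where
  "mvn_dens m S v = exp (- (1 / 2) * ((v - m) \<bullet> (matrix_inv S *v (v - m))))
                     / sqrt ((2 * pi) ^ CARD('d) * det S)"

definition lik :: "(real \<Rightarrow> real) \<Rightarrow> ('n \<Rightarrow> nat) \<Rightarrow> ('n \<Rightarrow> real^'p) \<Rightarrow> ('n \<Rightarrow> real^'q)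
                   \<Rightarrow> real^'p \<Rightarrow> real^'q^'n \<Rightarrow> 'n \<Rightarrow> real" where
  "lik f y x g \<beta> \<xi> i =
     (LBINT u:{0<..}. f u * poisson_dens (y i) (u * exp (x i \<bullet> \<beta> + g i \<bullet> (\<xi> $ i))))"

definition unnorm_post :: "((real^'p) \<times> (real^'q^'n) \<Rightarrow> real) \<Rightarrow> (real \<Rightarrow> real) \<Rightarrow> ('n \<Rightarrow> nat)
     \<Rightarrow> ('n \<Rightarrow> real^'p) \<Rightarrow> ('n \<Rightarrow> real^'q) \<Rightarrow> 'n set \<Rightarrow> (real^'p) \<times> (real^'q^'n) \<Rightarrow> real" where
  "unnorm_post prior f y x g K z = prior z * (\<Prod>i\<in>K. lik f y x g (fst z) (snd z) i)"

definition posterior :: "((real^'p) \<times> (real^'q^'n) \<Rightarrow> real) \<Rightarrow> (real \<Rightarrow> real) \<Rightarrow> ('n \<Rightarrow> nat)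
     \<Rightarrow> ('n \<Rightarrow> real^'p) \<Rightarrow> ('n \<Rightarrow> real^'q) \<Rightarrow> 'n set \<Rightarrow> (real^'p) \<times> (real^'q^'n) \<Rightarrow> real" where
  "posterior prior f y x g K z =
     unnorm_post prior f y x g K z / integral\<^sup>L lborel (unnorm_post prior f y x g K)"

end

theory Submission
  imports Defs "HOL-Probability.Probability" "HOL-Real_Asymp.Real_Asymp"
begin

text \<open>
  Writing \<open>W(t) = (1 + |t|)\<^bsup>3/2\<^esup>\<close>, the mixing density satisfies \<open>u f(u) W(ln u) \<le> C\<close> and this product
  tends to \<open>s/\<pi>\<close> at infinity. Since \<open>u f(u)\<close> varies slowly and the Poisson likelihood is, as a
  function of \<open>u\<close>, a gamma density times \<open>u/y\<close>, the marginal likelihood \<open>N(y,\<lambda>)\<close> of a count \<open>y\<close>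
  with rate \<open>\<lambda>\<close> satisfies \<open>y W(ln y) N(y,\<lambda>) \<rightarrow> s/\<pi>\<close>, a limit that does not depend on \<open>\<lambda>\<close>: after
  rescaling, the outliers drop out pointwise. To pass to the limit in the normalising constant,
  submultiplicativity of \<open>W\<close> gives \<open>y W(ln y) N(y,\<lambda>) \<le> B W(ln \<lambda>)\<close> for each outlier and
  \<open>N(y,\<lambda>) \<le> A / W(ln \<lambda>)\<close> for each positive non-outlying count. By general position all but
  \<open>p - 1\<close> of the latter grow like \<open>W(\<parallel>\<beta>\<parallel>)\<close>, so the cardinality condition makes the quotient of the
  products of weights bounded in \<open>\<beta>\<close> and polynomial in \<open>\<xi>\<close>, which the Gaussian prior integrates.
\<close>

subsection \<open>Logarithmic weights\<close>

text \<open>The tail of \<open>H_dens\<close> is of order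
  \<open>1 / (u * (ln u) powr (3 / 2))\<close>, whence the exponent. The shift by 1 makes the weight
  at least 1 and submultiplicative; the absolute value treats small and large arguments of the
  logarithm alike.\<close>

definition log_weight :: "real \<Rightarrow> real" where
  "log_weight t = (1 + \<bar>t\<bar>) powr (3 / 2)"

lemma log_weight_ge_1: "log_weight t \<ge> 1"
  unfolding log_weight_def by (rule ge_one_powr_ge_zero) auto

lemma log_weight_pos: "log_weight t > 0"
  using log_weight_ge_1[of t] by linarith

lemma log_weight_minus [simp]: "log_weight (- t) = log_weight t"
  by (simp add: log_weight_def)

lemma one_plus_abs_add_le: "1 + \<bar>a + b\<bar> \<le> (1 + \<bar>a\<bar>) * (1 + \<bar>b\<bar>)" for a b :: real
proof -
  have "\<bar>a + b\<bar> \<le> \<bar>a\<bar> + \<bar>b\<bar> + \<bar>a\<bar> * \<bar>b\<bar>"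
    using abs_triangle_ineq[of a b] by (simp add: add_increasing2)
  then show ?thesis by (simp add: algebra_simps)
qed

lemma log_weight_add_le: "log_weight (a + b) \<le> log_weight a * log_weight b"
proof -
  have "(1 + \<bar>a + b\<bar>) powr (3 / 2) \<le> ((1 + \<bar>a\<bar>) * (1 + \<bar>b\<bar>)) powr (3 / 2)"
    by (intro powr_mono2 one_plus_abs_add_le) auto
  then show ?thesis by (simp add: log_weight_def powr_mult)
qed

lemma log_weight_measurable [measurable]: "log_weight \<in> borel_measurable borel"
  unfolding log_weight_def by measurable

text \<open>The limits bound \<open>F\<close> near 0 and near infinity; continuity covers the
  compact interval in between.\<close>

lemma bounded_above_on_pos_reals:
  fixes F :: "real \<Rightarrow> real"
  assumes cont: "continuous_on {0<..} F"
    and top: "(F \<longlongrightarrow> a) at_top" and zero: "(F \<longlongrightarrow> b) (at_right 0)"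
  shows "\<exists>C>0. \<forall>u>0. F u \<le> C"
proof -
  have "eventually (\<lambda>u. F u < a + 1) at_top"
    by (rule order_tendstoD[OF top]) simp
  then obtain T where T: "\<And>u. u \<ge> T \<Longrightarrow> F u < a + 1"
    by (auto simp: eventually_at_top_linorder)
  have "eventually (\<lambda>u. F u < b + 1) (at_right 0)"
    by (rule order_tendstoD[OF zero]) simp
  then obtain d where d: "d > 0" "\<And>u. 0 < u \<Longrightarrow> u < d \<Longrightarrow> F u < b + 1"
    by (auto simp: eventually_at_right_field)
  have "compact (F ` {d..T})"
    by (intro compact_continuous_image continuous_on_subset[OF cont]) (use d in auto)
  then obtain B where B: "\<And>u. u \<in> {d..T} \<Longrightarrow> \<bar>F u\<bar> \<le> B"
    by (metis bounded_real compact_imp_bounded imageI)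
  have "F u \<le> \<bar>a\<bar> + \<bar>b\<bar> + \<bar>B\<bar> + 1" if "u > 0" for u
    using T[of u] d(2)[of u] B[of u] that by (cases "u \<ge> T"; cases "u < d") auto
  then show ?thesis by (intro exI[of _ "\<bar>a\<bar> + \<bar>b\<bar> + \<bar>B\<bar> + 1"]) auto
qed

text \<open>Powers of logarithms grow more slowly than any power. The exponents are halves so that
  the gamma moment of order \<open>- 1 / 2\<close> is finite for every shape from 1 on.\<close>

lemma log_weight_ln_le_powr:
  "\<exists>C>0. \<forall>v>0. log_weight (ln v) \<le> C * (v powr (1 / 2) + v powr (- 1 / 2))"
proof -
  define F where "F = (\<lambda>v::real. log_weight (ln v) / (v powr (1 / 2) + v powr (- 1 / 2)))"
  have "\<exists>C>0. \<forall>u>0. F u \<le> C"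
  proof (rule bounded_above_on_pos_reals)
    show "continuous_on {0<..} F"
      unfolding F_def log_weight_def
      by (intro continuous_intros) (auto simp: add_nonneg_eq_0_iff)
    show "(F \<longlongrightarrow> 0) at_top"
    proof (rule Lim_transform_eventually)
      show "((\<lambda>v::real. (1 + ln v) powr (3/2) / (v powr (1 / 2) + v powr (- 1 / 2))) \<longlongrightarrow> 0) at_top"
        by real_asymp
      show "eventually (\<lambda>v. (1 + ln v) powr (3/2) / (v powr (1 / 2) + v powr (- 1 / 2)) = F v) at_top"
        using eventually_ge_at_top[of 1] by eventually_elim (simp add: F_def log_weight_def)
    qed
    show "(F \<longlongrightarrow> 0) (at_right 0)"
    proof (rule Lim_transform_eventually)
      show "((\<lambda>v::real. (1 - ln v) powr (3/2) / (v powr (1 / 2) + v powr (- 1 / 2))) \<longlongrightarrow> 0) (at_right 0)"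
        by real_asymp
      show "eventually (\<lambda>v. (1 - ln v) powr (3/2) / (v powr (1 / 2) + v powr (- 1 / 2)) = F v) (at_right 0)"
        unfolding eventually_at_right_field
        by (intro exI[of _ 1]) (auto simp add: F_def log_weight_def)
    qed
  qed
  then obtain C where C: "C > 0" "\<And>u. u > 0 \<Longrightarrow> F u \<le> C" by auto
  have "log_weight (ln v) \<le> C * (v powr (1 / 2) + v powr (- 1 / 2))" if "v > 0" for v
    using C(2)[OF that] that unfolding F_def
    by (subst (asm) pos_divide_le_eq) (auto intro!: add_pos_pos)
  with C(1) show ?thesis by auto
qed

text \<open>Slow variation of the weight, uniform over shifts of size at most \<open>D\<close>: for
  nonnegative arguments the quotient of \<open>1 + a\<close> and \<open>1 + c\<close> is within
  \<open>D / (1 + c)\<close> of 1.\<close>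

lemma log_weight_ratio:
  assumes "D \<ge> 0" "e > 0"
  shows "\<exists>T. \<forall>a\<ge>T. \<forall>c. \<bar>a - c\<bar> \<le> D \<longrightarrow> \<bar>log_weight a / log_weight c - 1\<bar> < e"
proof -
  have "isCont (\<lambda>t::real. t powr (3 / 2)) 1"
    by (intro continuous_intros) auto
  then obtain d where d: "d > 0" "\<And>t::real. \<bar>t - 1\<bar> < d \<Longrightarrow> \<bar>t powr (3 / 2) - 1\<bar> < e"
    using assms(2) unfolding continuous_at_eps_delta dist_real_def
    by (metis powr_one_eq_one)
  show ?thesis
  proof (intro exI allI impI)
    \<comment> \<open>The threshold is chosen so that \<open>c\<close> is still at least
      \<open>D / d\<close>, which makes \<open>D / (1 + c)\<close> smaller than
      \<open>d\<close>.\<close>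
    fix a c assume a: "a \<ge> D + D / d" and ac: "\<bar>a - c\<bar> \<le> D"
    then have c: "c \<ge> D / d" by linarith
    have "D / d \<ge> 0" using assms d by simp
    with a c assms(1) have pos: "a \<ge> 0" "c \<ge> 0" by linarith+
    have "(1 + a) / (1 + c) - 1 = (a - c) / (1 + c)" using pos by (simp add: field_simps)
    also have "\<bar>\<dots>\<bar> \<le> D / (1 + c)" using pos ac by (simp add: abs_divide divide_right_mono)
    also have "\<dots> < d" using pos c d by (simp add: field_simps)
    finally have "\<bar>((1 + a) / (1 + c)) powr (3 / 2) - 1\<bar> < e" by (rule d(2))
    then show "\<bar>log_weight a / log_weight c - 1\<bar> < e"
      using pos by (simp add: log_weight_def powr_divide)
  qed
qed

text \<open>With \<open>p = sqrt r + 1 / sqrt r\<close> at least 2,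
  \<open>r + 1 / r - p = (p - 2) * (p + 1)\<close> is nonnegative. Whole powers serve the outliers:
  the gamma means of \<open>r\<close> and \<open>1 / r\<close> are explicit in the shape, so the
  resulting bounds are uniform in the count.\<close>

lemma log_weight_ln_le:
  "\<exists>C>0. \<forall>r>0. log_weight (ln r) \<le> C * (r + 1 / r)"
proof -
  obtain C where C: "C > 0" "\<And>v. v > 0 \<Longrightarrow> log_weight (ln v) \<le> C * (v powr (1 / 2) + v powr (- 1 / 2))"
    using log_weight_ln_le_powr by auto
  have "log_weight (ln r) \<le> C * (r + 1 / r)" if r: "r > 0" for r
  proof -
    define p where "p = sqrt r + 1 / sqrt r"
    have "p - 2 = (sqrt r - 1)\<^sup>2 / sqrt r"
      using r by (simp add: p_def power2_eq_square field_simps)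
    then have "p \<ge> 2" using r by (metis divide_nonneg_nonneg diff_ge_0_iff_ge real_sqrt_ge_0_iff less_imp_le zero_le_power2)
    then have "0 \<le> (p - 2) * (p + 1)" by simp
    moreover have "p\<^sup>2 = r + 1 / r + 2"
      using r by (simp add: p_def power2_sum power_divide)
    ultimately have *: "p \<le> r + 1 / r" by (simp add: algebra_simps power2_eq_square)
    have "r powr (- 1 / 2) = 1 / sqrt r" using r by (simp add: powr_minus powr_half_sqrt inverse_eq_divide)
    then have "log_weight (ln r) \<le> C * p" unfolding p_def using C(2)[OF r] r by (simp add: powr_half_sqrt)
    also have "\<dots> \<le> C * (r + 1 / r)" using * C(1) by (intro mult_left_mono) auto
    finally show ?thesis .
  qed
  with C(1) show ?thesis by auto
qed

subsection \<open>Gamma and Poisson densities\<close>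

lemma gamma_dens_measurable [measurable]: "gamma_dens a b \<in> borel_measurable borel"
  unfolding gamma_dens_def by measurable

lemma gamma_dens_nonneg: "a > 0 \<Longrightarrow> gamma_dens a b u \<ge> 0"
  by (auto simp: gamma_dens_def Gamma_real_pos less_imp_le)

text \<open>The substitution of \<open>b * u\<close> reduces the total mass to Euler's integral for
  \<open>Gamma\<close>.\<close>

lemma gamma_dens_has_integral:
  assumes "a > 0" "b > 0"
  shows "has_bochner_integral lborel (gamma_dens a b) 1"
proof (rule has_bochner_integral_nn_integral)
  have G: "Gamma a > 0" using assms by (simp add: Gamma_real_pos)
  have "(\<integral>\<^sup>+u. ennreal (gamma_dens a b u) \<partial>lborel)
      = (\<integral>\<^sup>+u. ennreal (1 / Gamma a) * (ennreal b * ennreal (indicator {0..} (b * u) * (b * u) powr (a - 1) / exp (b * u))) \<partial>lborel)"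
    (is "_ = nn_integral _ ?h")
  proof (rule nn_integral_cong_AE, rule AE_mp[OF AE_lborel_singleton[of 0]], intro AE_I2 impI)
    fix u :: real assume u: "u \<noteq> 0"
    show "ennreal (gamma_dens a b u) = ?h u"
    proof (cases "u > 0")
      case True
      have "b powr a = b * b powr (a - 1)" using assms by (simp add: powr_diff)
      then have "gamma_dens a b u = 1 / Gamma a * (b * (indicator {0..} (b * u) * (b * u) powr (a - 1) / exp (b * u)))"
        using True assms by (simp add: gamma_dens_def powr_mult exp_minus divide_inverse)
      then show ?thesis using True assms G by (simp add: ennreal_mult[symmetric])
    next
      case False
      with u assms have "b * u < 0" by (simp add: mult_pos_neg)
      with False show ?thesis by (simp add: gamma_dens_def)
    qed
  qed
  also have "\<dots> = ennreal (1 / Gamma a) * (ennreal b * (\<integral>\<^sup>+u. ennreal (indicator {0..} (b * u) * (b * u) powr (a - 1) / exp (b * u)) \<partial>lborel))"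
    by (simp add: nn_integral_cmult)
  also have "ennreal b * (\<integral>\<^sup>+u. ennreal (indicator {0..} (b * u) * (b * u) powr (a - 1) / exp (b * u)) \<partial>lborel)
      = (\<integral>\<^sup>+u. ennreal (indicator {0..} u * u powr (a - 1) / exp u) \<partial>lborel)"
    using nn_integral_real_affine[of "\<lambda>u. ennreal (indicator {0..} u * u powr (a - 1) / exp u)" b 0] assms
    by simp
  also have "\<dots> = ennreal (Gamma a)"
    by (rule Gamma_conv_nn_integral_real[OF assms(1), symmetric])
  also have "ennreal (1 / Gamma a) * ennreal (Gamma a) = ennreal 1"
    using G by (subst ennreal_mult[symmetric]) auto
  finally show "(\<integral>\<^sup>+u. ennreal (gamma_dens a b u) \<partial>lborel) = ennreal 1" .
qed (use assms in \<open>auto simp: gamma_dens_nonneg\<close>)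

lemma gamma_dens_integrable: "a > 0 \<Longrightarrow> b > 0 \<Longrightarrow> integrable lborel (gamma_dens a b)"
  and gamma_dens_integral: "a > 0 \<Longrightarrow> b > 0 \<Longrightarrow> integral\<^sup>L lborel (gamma_dens a b) = 1"
  using gamma_dens_has_integral by (auto simp: has_bochner_integral_iff)

text \<open>A power of \<open>u * b\<close> only shifts the shape, so moments can be read off from
  total masses. Negative \<open>c\<close> is allowed while the new shape stays positive.\<close>

lemma gamma_dens_shift:
  assumes "a > 0" "a + c > 0" "b > 0" "u > 0"
  shows "(u * b) powr c * gamma_dens a b u = Gamma (a + c) / Gamma a * gamma_dens (a + c) b u"
proof -
  have "Gamma (a + c) \<noteq> 0" "Gamma a \<noteq> 0"
    using assms Gamma_real_pos[of a] Gamma_real_pos[of "a + c"] by linarith+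
  then show ?thesis using assms
    by (simp add: gamma_dens_def powr_mult powr_add powr_diff field_simps)
qed

text \<open>The count becomes a shape and so has to be positive. The factor \<open>u\<close> split
  off here joins the mixing density to form the slowly varying \<open>u * f u\<close>.\<close>

lemma poisson_dens_eq_gamma_dens:
  assumes "y \<ge> 1" "b > 0" "u > 0"
  shows "poisson_dens y (u * b) = u / real y * gamma_dens (real y) b u"
proof -
  obtain k where k: "y = Suc k" using assms(1) by (cases y) auto
  have "Gamma (1 + real k) = fact k"
    by (simp add: Gamma_fact)
  then have "gamma_dens (real y) b u = b ^ y * u ^ k * exp (- b * u) / fact k"
    using assms unfolding k gamma_dens_def
    by (simp add: powr_realpow[of b "Suc k", simplified] powr_realpow[of u k])
  then show ?thesis
    using assms unfolding k
    by (simp add: poisson_dens_def power_mult_distrib field_simps del: of_nat_Suc)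
qed

text \<open>The scaling \<open>u * b / a\<close> has mean 1 under the gamma density with shape
  \<open>a\<close> and rate \<open>b\<close>; by \<open>gamma_dens_divide\<close> its reciprocal has
  mean \<open>a / (a - 1)\<close>.\<close>

lemma gamma_dens_mult:
  assumes "a > 0" "b > 0"
  shows "u * b / a * gamma_dens a b u = gamma_dens (a + 1) b u"
proof (cases "u > 0")
  case True
  have "Gamma (a + 1) = a * Gamma a" using assms by (intro Gamma_plus1) auto
  moreover have "Gamma a \<noteq> 0" using Gamma_real_pos[of a] assms by linarith
  ultimately have "u * b * gamma_dens a b u = a * gamma_dens (a + 1) b u"
    using gamma_dens_shift[of a 1 b u] assms True by simp
  then show ?thesis using assms by (simp add: field_simps)
qed (simp add: gamma_dens_def)

lemma gamma_dens_divide: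
  assumes "a > 1" "b > 0"
  shows "1 / (u * b / a) * gamma_dens a b u = a / (a - 1) * gamma_dens (a - 1) b u"
proof (cases "u > 0")
  case True
  have "gamma_dens a b u = u * b / (a - 1) * gamma_dens (a - 1) b u"
    using gamma_dens_mult[of "a - 1" b u] assms by simp
  then show ?thesis using assms True by simp
qed (simp add: gamma_dens_def)

lemma poisson_dens_nonneg: "\<mu> \<ge> 0 \<Longrightarrow> poisson_dens k \<mu> \<ge> 0"
  by (simp add: poisson_dens_def)

lemma poisson_dens_pos: "\<mu> > 0 \<Longrightarrow> poisson_dens k \<mu> > 0"
  by (simp add: poisson_dens_def)

lemma poisson_dens_le_1:
  assumes "\<mu> > 0"
  shows "poisson_dens k \<mu> \<le> 1"
  using pmf_le_1[of "poisson_pmf \<mu>" k] assms by (simp add: poisson_dens_def)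

lemma poisson_dens_measurable [measurable]: "poisson_dens k \<in> borel_measurable borel"
  unfolding poisson_dens_def by measurable

subsection \<open>Poisson mixtures with a log-regularly varying mixing density\<close>

definition poisson_mixture :: "(real \<Rightarrow> real) \<Rightarrow> nat \<Rightarrow> real \<Rightarrow> real" where
  "poisson_mixture f y b = (LBINT u:{0<..}. f u * poisson_dens y (u * b))"

text \<open>These are the features of the mixing density on which the limit argument rests:
  \<open>bound\<close> holds on the whole half line and supplies dominating functions, while
  \<open>lim\<close> fixes the tail constant.\<close>

locale log_regular_density =
  fixes f :: "real \<Rightarrow> real" and \<kappa> C :: real
  assumes meas [measurable]: "f \<in> borel_measurable borel"
    and pos: "\<And>u. u > 0 \<Longrightarrow> f u > 0"
    and int: "set_integrable lborel {0<..} f"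
    and bound: "\<And>u. u > 0 \<Longrightarrow> u * f u * log_weight (ln u) \<le> C"
    and lim: "((\<lambda>u. u * f u * log_weight (ln u)) \<longlongrightarrow> \<kappa>) at_top"
begin

lemma C_pos: "C > 0"
proof -
  have "0 < f 1 * log_weight 0" using pos[of 1] log_weight_pos by simp
  also have "\<dots> \<le> C" using bound[of 1] by simp
  finally show ?thesis .
qed

lemma mixture_integrable:
  assumes "b > 0"
  shows "set_integrable lborel {0<..} (\<lambda>u. f u * poisson_dens y (u * b))"
proof (rule set_integrable_bound[OF int])
  show "AE u in lborel. u \<in> {0<..} \<longrightarrow> norm (f u * poisson_dens y (u * b)) \<le> norm (f u)"
    using assms by (intro AE_I2 impI) (auto simp: abs_mult poisson_dens_nonneg intro!: mult_right_le_one_le poisson_dens_le_1)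
  show "set_borel_measurable lborel {0<..} (\<lambda>u. f u * poisson_dens y (u * b))"
    unfolding set_borel_measurable_def by measurable
qed

lemma mixture_nonneg:
  assumes "b > 0"
  shows "poisson_mixture f y b \<ge> 0"
  unfolding poisson_mixture_def set_lebesgue_integral_def using assms
  by (intro integral_nonneg_AE AE_I2)
    (auto simp: indicator_def poisson_dens_nonneg pos less_imp_le intro!: mult_nonneg_nonneg)

text \<open>A vanishing integral would force the positive integrand to vanish almost everywhere on
  the unit interval. Strict positivity later keeps the limiting normalising constant away from
  0.\<close>

lemma mixture_pos:
  assumes "b > 0"
  shows "poisson_mixture f y b > 0"
proof (rule ccontr)
  assume "\<not> ?thesis"
  with mixture_nonneg[OF assms, of y] have "poisson_mixture f y b = 0" by simp
  let ?h = "\<lambda>u. indicator {0<..} u *\<^sub>R (f u * poisson_dens y (u * b))"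
  have int: "integrable lborel ?h"
    using mixture_integrable[OF assms] by (simp add: set_integrable_def)
  have "AE u in lborel. 0 \<le> ?h u"
    using assms by (intro AE_I2) (auto simp: indicator_def poisson_dens_nonneg pos less_imp_le)
  then have "AE u in lborel. ?h u = 0"
    using integral_nonneg_eq_0_iff_AE[OF int] \<open>poisson_mixture f y b = 0\<close>
    by (simp add: poisson_mixture_def set_lebesgue_integral_def)
  then have "AE u in lborel. u \<notin> {0<..<1::real}"
  proof eventually_elim
    case (elim u)
    then show ?case
      using assms pos[of u] poisson_dens_pos[of "u * b" y] by (cases "u > 0") auto
  qed
  moreover have "{u::real. \<not> u \<notin> {0<..<1}} = {0<..<1}" by auto
  ultimately have "emeasure lborel {0<..<1::real} = 0"
    by (subst (asm) AE_iff_measurable[OF _ refl]) simp_all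
  moreover have "emeasure lborel {0<..<1::real} = 1" by simp
  ultimately show False by simp
qed

lemma mixture_le:
  assumes "b > 0"
  shows "poisson_mixture f y b \<le> (LBINT u:{0<..}. f u)"
  unfolding poisson_mixture_def
proof (rule set_integral_mono[OF mixture_integrable[OF assms] int])
  fix u :: real assume "u \<in> {0<..}"
  then show "f u * poisson_dens y (u * b) \<le> f u"
    using assms pos[of u] poisson_dens_le_1[of "u * b" y] by (simp add: mult_left_le)
qed

lemma mixture_measurable [measurable]:
  "poisson_mixture f y \<in> borel_measurable borel"
  unfolding poisson_mixture_def set_lebesgue_integral_def by measurable

lemma tail_integrable:
  assumes "a > 0" "b > 0"
  shows "integrable lborel (\<lambda>u. u * f u * gamma_dens a b u)"
proof (rule Bochner_Integration.integrable_bound)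
  show "integrable lborel (\<lambda>u. C * gamma_dens a b u)"
    using assms by (intro integrable_mult_right gamma_dens_integrable)
  show "AE u in lborel. norm (u * f u * gamma_dens a b u) \<le> norm (C * gamma_dens a b u)"
  proof (rule AE_I2)
    fix u :: real
    show "norm (u * f u * gamma_dens a b u) \<le> norm (C * gamma_dens a b u)"
    proof (cases "u > 0")
      case True
      have "u * f u * 1 \<le> u * f u * log_weight (ln u)"
        using True pos[of u] log_weight_ge_1 by (intro mult_left_mono) auto
      with bound[OF True] have "u * f u \<le> C" by linarith
      with True pos[of u] C_pos show ?thesis
        by (auto simp: abs_mult intro!: mult_right_mono)
    qed (simp add: gamma_dens_def)
  qed
qed measurable

lemma mixture_eq:
  assumes "y \<ge> 1" "b > 0"
  shows "real y * poisson_mixture f y b = (LINT u|lborel. u * f u * gamma_dens (real y) b u)"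
proof -
  have "real y * poisson_mixture f y b = (LINT u|lborel. real y * (indicator {0<..} u *\<^sub>R (f u * poisson_dens y (u * b))))"
    by (simp add: poisson_mixture_def set_lebesgue_integral_def)
  also have "\<dots> = (LINT u|lborel. u * f u * gamma_dens (real y) b u)"
    using assms by (intro Bochner_Integration.integral_cong)
      (auto simp: indicator_def poisson_dens_eq_gamma_dens gamma_dens_def)
  finally show ?thesis .
qed

text \<open>Splitting \<open>ln b = ln (u * b) - ln u\<close> by submultiplicativity extracts the
  decay in \<open>b\<close>; what remains depends only on \<open>u * b\<close>, whose gamma
  distribution is free of \<open>b\<close>.\<close>

lemma tail_le:
  assumes "u > 0" "b > 0"
  shows "u * f u \<le> C / log_weight (ln b) * log_weight (ln (u * b))"
proof -
  have "log_weight (ln b) \<le> log_weight (ln (u * b)) * log_weight (ln u)"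
    using log_weight_add_le[of "ln (u * b)" "- ln u"] assms by (simp add: ln_mult)
  then have "u * f u * log_weight (ln b) \<le> u * f u * (log_weight (ln (u * b)) * log_weight (ln u))"
    using pos[of u] assms by (intro mult_left_mono) auto
  also have "\<dots> = u * f u * log_weight (ln u) * log_weight (ln (u * b))" by simp
  also have "\<dots> \<le> C * log_weight (ln (u * b))"
    using bound[of u] assms log_weight_pos[of "ln (u * b)"] by (intro mult_right_mono) auto
  finally show ?thesis using log_weight_pos[of "ln b"] by (simp add: field_simps)
qed

text \<open>After \<open>tail_le\<close> the remaining weight is bounded by half powers of
  \<open>u * b\<close>, whose gamma moments do not involve \<open>b\<close>. The constant may depend
  on \<open>y\<close>, since this is applied to the fixed counts.\<close>

lemma mixture_decay:
  assumes "y \<ge> 1"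
  shows "\<exists>A>0. \<forall>b>0. poisson_mixture f y b \<le> A / log_weight (ln b)"
proof -
  obtain C1 where C1: "C1 > 0" "\<And>v. v > 0 \<Longrightarrow> log_weight (ln v) \<le> C1 * (v powr (1 / 2) + v powr (- 1 / 2))"
    using log_weight_ln_le_powr by auto
  define a where "a = real y"
  \<comment> \<open>These are the gamma moments of \<open>u * b\<close> of orders
    \<open>1 / 2\<close> and \<open>- 1 / 2\<close>; the second exists because the shape is at least
    1.\<close>
  define cp cm where "cp = Gamma (a + 1 / 2) / Gamma a" and "cm = Gamma (a + - 1 / 2) / Gamma a"
  have a: "a \<ge> 1" using assms by (simp add: a_def)
  have c: "cp > 0" "cm > 0" unfolding cp_def cm_def using a by (auto intro!: divide_pos_pos Gamma_real_pos)
  have "poisson_mixture f y b \<le> C * C1 * (cp + cm) / log_weight (ln b)" if b: "b > 0" for b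
  proof -
    let ?M = "C / log_weight (ln b) * C1"
    have "u * f u * gamma_dens a b u \<le> ?M * (cp * gamma_dens (a + 1 / 2) b u + cm * gamma_dens (a + - 1 / 2) b u)" for u
    proof (cases "u > 0")
      case u: True
      have "u * f u \<le> C / log_weight (ln b) * log_weight (ln (u * b))" by (rule tail_le[OF u b])
      also have "\<dots> \<le> C / log_weight (ln b) * (C1 * ((u * b) powr (1 / 2) + (u * b) powr (- 1 / 2)))"
        using C1(2)[of "u * b"] u b C_pos log_weight_pos[of "ln b"] by (intro mult_left_mono) auto
      finally have "u * f u * gamma_dens a b u \<le> C / log_weight (ln b) * (C1 * ((u * b) powr (1 / 2) + (u * b) powr (- 1 / 2))) * gamma_dens a b u"
        using gamma_dens_nonneg[of a b u] a by (intro mult_right_mono) auto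
      also have "\<dots> = ?M * ((u * b) powr (1 / 2) * gamma_dens a b u + (u * b) powr (- 1 / 2) * gamma_dens a b u)"
        by (simp add: algebra_simps)
      also have "(u * b) powr (1 / 2) * gamma_dens a b u = cp * gamma_dens (a + 1 / 2) b u"
        unfolding cp_def using a b u by (intro gamma_dens_shift) auto
      also have "(u * b) powr (- 1 / 2) * gamma_dens a b u = cm * gamma_dens (a + - 1 / 2) b u"
        unfolding cm_def using a b u by (intro gamma_dens_shift) auto
      finally show ?thesis .
    qed (simp add: gamma_dens_def)
    then have "real y * poisson_mixture f y b \<le> (LINT u|lborel. ?M * (cp * gamma_dens (a + 1 / 2) b u + cm * gamma_dens (a + - 1 / 2) b u))"
      unfolding mixture_eq[OF assms b] unfolding a_def[symmetric] using a b
      by (intro integral_mono tail_integrable integrable_mult_right Bochner_Integration.integrable_add gamma_dens_integrable) auto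
    also have "\<dots> = ?M * (cp + cm)"
      using a b by (simp add: gamma_dens_integrable gamma_dens_integral)
    finally have "real y * poisson_mixture f y b \<le> ?M * (cp + cm)" .
    moreover have "poisson_mixture f y b \<le> real y * poisson_mixture f y b"
      using assms mixture_nonneg[OF b, of y] by (simp add: mult_le_cancel_right1)
    ultimately show ?thesis by simp
  qed
  then show ?thesis
    using c C_pos C1(1) by (intro exI[of _ "C * C1 * (cp + cm)"]) auto
qed

text \<open>The splitting is \<open>ln a = ln u + ln b - ln (u * b / a)\<close>: the first weight is
  absorbed by \<open>bound\<close>, the second is constant in \<open>u\<close>, and the third
  depends on the variable that concentrates at 1.\<close>

lemma scaled_tail_le:
  assumes "u > 0" "b > 0" "a > 0"
  shows "log_weight (ln a) * (u * f u) \<le> C * log_weight (ln b) * log_weight (ln (u * b / a))"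
proof -
  have "log_weight (ln a) \<le> log_weight (ln u) * log_weight (ln b - ln (u * b / a))"
    using log_weight_add_le[of "ln u" "ln b - ln (u * b / a)"] assms by (simp add: ln_mult ln_div)
  also have "\<dots> \<le> log_weight (ln u) * (log_weight (ln b) * log_weight (ln (u * b / a)))"
    using log_weight_add_le[of "ln b" "- ln (u * b / a)"] log_weight_pos[of "ln u"]
    by (intro mult_left_mono) auto
  finally have "log_weight (ln a) * (u * f u) \<le> log_weight (ln u) * (log_weight (ln b) * log_weight (ln (u * b / a))) * (u * f u)"
    using pos[of u] assms by (intro mult_right_mono) auto
  also have "\<dots> = u * f u * log_weight (ln u) * (log_weight (ln b) * log_weight (ln (u * b / a)))" by simp
  also have "\<dots> \<le> C * (log_weight (ln b) * log_weight (ln (u * b / a)))"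
    using bound[of u] assms log_weight_pos by (intro mult_right_mono) (auto intro: less_imp_le)
  finally show ?thesis by simp
qed

text \<open>By \<open>scaled_tail_le\<close> the integrand is controlled by \<open>r + 1 / r\<close>
  with \<open>r = u * b / y\<close>, whose mean is \<open>1 + y / (y - 1)\<close>. For
  \<open>y\<close> at least 2 this is at most 3, which gives a constant uniform in both
  \<open>y\<close> and \<open>b\<close>.\<close>

lemma scaled_mixture_le:
  "\<exists>B>0. \<forall>y\<ge>2. \<forall>b>0. real y * log_weight (ln (real y)) * poisson_mixture f y b \<le> B * log_weight (ln b)"
proof -
  obtain C2 where C2: "C2 > 0" "\<And>r. r > 0 \<Longrightarrow> log_weight (ln r) \<le> C2 * (r + 1 / r)"
    using log_weight_ln_le by auto
  have "real y * log_weight (ln (real y)) * poisson_mixture f y b \<le> 3 * C * C2 * log_weight (ln b)"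
    if y: "y \<ge> 2" and b: "b > 0" for y b
  proof -
    define a where "a = real y"
    have a: "a \<ge> 2" using y by (simp add: a_def)
    let ?M = "C * log_weight (ln b) * C2"
    have M: "?M > 0" using C_pos C2(1) log_weight_pos[of "ln b"] by simp
    have "log_weight (ln a) * (u * f u * gamma_dens a b u) \<le> ?M * (gamma_dens (a + 1) b u + a / (a - 1) * gamma_dens (a - 1) b u)" for u
    proof (cases "u > 0")
      case u: True
      have "log_weight (ln a) * (u * f u) \<le> C * log_weight (ln b) * log_weight (ln (u * b / a))"
        by (rule scaled_tail_le) (use a b u in auto)
      also have "\<dots> \<le> C * log_weight (ln b) * (C2 * (u * b / a + 1 / (u * b / a)))"
        using C_pos log_weight_pos[of "ln b"] C2(2)[of "u * b / a"] u a b by (intro mult_left_mono) auto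
      finally have "log_weight (ln a) * (u * f u) * gamma_dens a b u \<le> C * log_weight (ln b) * (C2 * (u * b / a + 1 / (u * b / a))) * gamma_dens a b u"
        using a by (intro mult_right_mono gamma_dens_nonneg) auto
      also have "\<dots> = ?M * (u * b / a * gamma_dens a b u + 1 / (u * b / a) * gamma_dens a b u)"
        by (simp only: distrib_left distrib_right mult.assoc)
      also have "\<dots> = ?M * (gamma_dens (a + 1) b u + a / (a - 1) * gamma_dens (a - 1) b u)"
        using a b by (subst gamma_dens_mult, simp, simp, subst gamma_dens_divide) auto
      finally show ?thesis by (simp only: mult.assoc)
    qed (simp add: gamma_dens_def)
    then have "log_weight (ln a) * (LINT u|lborel. u * f u * gamma_dens a b u)
        \<le> (LINT u|lborel. ?M * (gamma_dens (a + 1) b u + a / (a - 1) * gamma_dens (a - 1) b u))"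
      unfolding integral_mult_right_zero[symmetric] using a b
      by (intro integral_mono tail_integrable integrable_mult_right Bochner_Integration.integrable_add gamma_dens_integrable) auto
    also have "\<dots> = ?M * (1 + a / (a - 1))"
      using a b by (simp add: gamma_dens_integrable gamma_dens_integral)
    also have "\<dots> \<le> ?M * 3"
      using M a by (intro mult_left_mono) (auto simp: field_simps)
    finally show ?thesis
      using mixture_eq[of y b, symmetric] y b by (simp add: a_def mult_ac)
  qed
  then show ?thesis using C_pos C2(1)
    by (intro exI[of _ "3 * C * C2"]) auto
qed

text \<open>Under the gamma density \<open>r = u * b / y\<close> concentrates at 1. For
  \<open>r\<close> between 1/2 and 3/2, slow variation puts
  \<open>log_weight (ln y) * (u * f u)\<close> close to \<open>\<kappa>\<close>; the other values of
  \<open>r\<close> contribute an error of order \<open>1 / y\<close>.\<close>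

lemma scaled_mixture_tendsto:
  assumes b: "b > 0"
  shows "(\<lambda>y. real y * log_weight (ln (real y)) * poisson_mixture f y b) \<longlonglongrightarrow> \<kappa>"
proof -
  obtain C2 where C2: "C2 > 0" "\<And>r. r > 0 \<Longrightarrow> log_weight (ln r) \<le> C2 * (r + 1 / r)"
    using log_weight_ln_le by auto
  define P where "P u = u * f u * log_weight (ln u)" for u
  \<comment> \<open>The bracket bounds the scaled tail and the constant \<open>\<kappa>\<close>
    together by a multiple of \<open>r + 1 / r\<close>; the factor 13 converts this into a multiple
    of \<open>(r - 1)\<^sup>2 / r\<close> for \<open>r\<close> outside the central interval.\<close>
  define M where "M = 13 * (C * log_weight (ln b) * C2 + \<bar>\<kappa>\<bar>)"
  have M: "M \<ge> 0" unfolding M_def using C_pos C2(1) log_weight_pos[of "ln b"] by simp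
  have "eventually (\<lambda>y. \<bar>real y * log_weight (ln (real y)) * poisson_mixture f y b - \<kappa>\<bar> < 2 * e) sequentially"
    if e: "e > 0" for e
  proof -
    \<comment> \<open>In the central range \<open>ln a - ln u = ln b - ln r\<close> and
      \<open>\<bar>ln r\<bar> \<le> ln 2\<close>, so \<open>D\<close> bounds the shift.\<close>
    define D where "D = \<bar>ln b\<bar> + ln 2"
    have D: "D \<ge> 0" by (simp add: D_def)
    \<comment> \<open>Since the product \<open>P u\<close> is at most \<open>C\<close>, a relative
      error \<open>e / (2 * C)\<close> in the weight costs \<open>e / 2\<close>; the other half is
      the distance of \<open>P u\<close> from its limit.\<close>
    obtain T where T: "\<And>s t. s \<ge> T \<Longrightarrow> \<bar>s - t\<bar> \<le> D \<Longrightarrow> \<bar>log_weight s / log_weight t - 1\<bar> < e / (2 * C)"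
      using log_weight_ratio[OF D, of "e / (2 * C)"] e C_pos by auto
    have "eventually (\<lambda>u. dist (P u) \<kappa> < e / 2) at_top"
      using tendstoD[OF lim, of "e / 2"] e by (simp add: P_def)
    then obtain U where U: "\<And>u. u \<ge> U \<Longrightarrow> \<bar>P u - \<kappa>\<bar> < e / 2"
      by (auto simp: eventually_at_top_linorder dist_real_def)
    \<comment> \<open>The condition with \<open>U\<close> is designed for the central range, where
      \<open>u = r * a / b\<close> is at least \<open>a / (2 * b)\<close> and hence at least
      \<open>U\<close>.\<close>
    have "eventually (\<lambda>y. ln (real y) \<ge> T) sequentially" "eventually (\<lambda>y. real y \<ge> 2 * b * U) sequentially"
      "eventually (\<lambda>y. M / (real y - 1) < e) sequentially" "eventually (\<lambda>y. y \<ge> (2::nat)) sequentially"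
      using e by real_asymp+
    then show ?thesis
    proof eventually_elim
      case (elim y)
      define a where "a = real y"
      have a: "a \<ge> 2" "ln a \<ge> T" "a \<ge> 2 * b * U" using elim by (auto simp: a_def)
      have central: "\<bar>log_weight (ln a) * (u * f u) - \<kappa>\<bar> \<le> e"
        if u: "u > 0" "u * b / a \<ge> 1 / 2" "u * b / a \<le> 3 / 2" for u
      proof -
        define Q where "Q = log_weight (ln a) / log_weight (ln u)"
        have "\<bar>ln (u * b / a)\<bar> \<le> ln 2"
        proof -
          have "u * b / a \<le> 2" "u * b / a > 0" using u(2,3) by linarith+
          then have "ln (1 / 2) \<le> ln (u * b / a)" "ln (u * b / a) \<le> ln 2"
            using u(2) by (intro ln_mono; simp)+
          then show ?thesis by (simp add: ln_div)
        qed
        then have "\<bar>ln a - ln u\<bar> \<le> D"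
          using u a b by (simp add: D_def ln_mult ln_div)
        then have Q: "\<bar>Q - 1\<bar> < e / (2 * C)" unfolding Q_def by (rule T[OF a(2)])
        have "a \<le> 2 * b * u" using a(1) u(2) by (simp add: le_divide_eq mult_ac)
        then have "2 * b * U \<le> 2 * b * u" using a(3) by linarith
        then have "U \<le> u" using b by (simp only: mult_le_cancel_left_pos)
        then have P: "\<bar>P u - \<kappa>\<bar> < e / 2" by (rule U)
        have "log_weight (ln a) * (u * f u) = P u * Q"
          using log_weight_pos[of "ln u"] by (simp add: P_def Q_def)
        then have "log_weight (ln a) * (u * f u) - \<kappa> = P u * (Q - 1) + (P u - \<kappa>)"
          by (simp add: algebra_simps)
        also have "\<bar>\<dots>\<bar> \<le> \<bar>P u\<bar> * \<bar>Q - 1\<bar> + \<bar>P u - \<kappa>\<bar>"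
          by (metis abs_mult abs_triangle_ineq)
        also have "\<bar>P u\<bar> * \<bar>Q - 1\<bar> \<le> C * (e / (2 * C))"
          using bound[OF u(1)] Q pos[OF u(1)] u log_weight_pos[of "ln u"] C_pos
          by (intro mult_mono) (auto simp: P_def abs_mult)
        also have "C * (e / (2 * C)) = e / 2" using C_pos by simp
        finally show ?thesis using P by simp
      qed
      \<comment> \<open>Away from \<open>r = 1\<close> the error is dominated by \<open>(r - 1)\<^sup>2 / r\<close>, whose mean under the gamma
        density with shape \<open>a\<close> is \<open>1 / (a - 1)\<close>.\<close>
      have outer: "\<bar>log_weight (ln a) * (u * f u) - \<kappa>\<bar> \<le> M * (r - 2 + 1 / r)"
        if u: "u > 0" "r < 1 / 2 \<or> r > 3 / 2" and r: "r = u * b / a" for u r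
      proof -
        have r0: "r > 0" using u a b r by simp
        have "r\<^sup>2 + 1 \<le> 13 * (r - 1)\<^sup>2"
        proof -
          \<comment> \<open>The roots 2/3 and 3/2 both lie in the central interval, so the quadratic
            is nonnegative outside it; 13 is the value of
            \<open>(r\<^sup>2 + 1) / (r - 1)\<^sup>2\<close> at 3/2.\<close>
          have "0 \<le> (2 * r - 3) * (3 * r - 2)"
            using u(2) r0 by (auto simp: zero_le_mult_iff)
          moreover have "13 * (r - 1)\<^sup>2 - (r\<^sup>2 + 1) = 2 * ((2 * r - 3) * (3 * r - 2))"
            by (simp add: power2_eq_square algebra_simps)
          ultimately show ?thesis by linarith
        qed
        then have "(r\<^sup>2 + 1) / r \<le> 13 * (r - 1)\<^sup>2 / r" using r0 by (intro divide_right_mono) auto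
        then have rr: "r + 1 / r \<le> 13 * (r - 2 + 1 / r)" using r0
          by (simp add: add_divide_distrib diff_divide_distrib power2_eq_square algebra_simps)
        have "0 \<le> (r - 1)\<^sup>2 / r" using r0 by simp
        then have "1 \<le> r + 1 / r"
          using r0 by (simp add: add_divide_distrib diff_divide_distrib power2_eq_square algebra_simps)
        then have "\<bar>\<kappa>\<bar> * 1 \<le> \<bar>\<kappa>\<bar> * (r + 1 / r)" by (intro mult_left_mono) auto
        moreover have "0 \<le> log_weight (ln a) * (u * f u)"
          using u pos[of u] log_weight_pos[of "ln a"] by simp
        ultimately have "\<bar>log_weight (ln a) * (u * f u) - \<kappa>\<bar> \<le> log_weight (ln a) * (u * f u) + \<bar>\<kappa>\<bar> * (r + 1 / r)"
          by linarith
        also have "log_weight (ln a) * (u * f u) \<le> C * log_weight (ln b) * log_weight (ln r)"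
          unfolding r by (rule scaled_tail_le) (use a b u in auto)
        also have "\<dots> \<le> C * log_weight (ln b) * (C2 * (r + 1 / r))"
          using C_pos log_weight_pos[of "ln b"] C2(2)[OF r0] by (intro mult_left_mono) auto
        also have "C * log_weight (ln b) * (C2 * (r + 1 / r)) + \<bar>\<kappa>\<bar> * (r + 1 / r)
            = (C * log_weight (ln b) * C2 + \<bar>\<kappa>\<bar>) * (r + 1 / r)"
          by (simp only: distrib_right mult.assoc)
        also have "\<dots> \<le> (C * log_weight (ln b) * C2 + \<bar>\<kappa>\<bar>) * (13 * (r - 2 + 1 / r))"
          using rr C_pos C2(1) log_weight_pos[of "ln b"] by (intro mult_left_mono) auto
        also have "\<dots> = M * (r - 2 + 1 / r)" by (simp only: M_def mult_ac)
        finally show ?thesis by simp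
      qed
      \<comment> \<open>This is \<open>e + M * (r - 2 + 1 / r)\<close> times the gamma density, with
        the factors \<open>r\<close> and \<open>1 / r\<close> absorbed into the shape. Its integral
        is \<open>e + M / (a - 1)\<close>.\<close>
      let ?h = "\<lambda>u. e * gamma_dens a b u + M * (gamma_dens (a + 1) b u - 2 * gamma_dens a b u + a / (a - 1) * gamma_dens (a - 1) b u)"
      have pointwise: "\<bar>log_weight (ln a) * (u * f u * gamma_dens a b u) - \<kappa> * gamma_dens a b u\<bar> \<le> ?h u" for u
      proof (cases "u > 0")
        case u: True
        define r where "r = u * b / a"
        have r0: "r > 0" using u a b by (simp add: r_def)
        have nn: "0 \<le> M * (r - 2 + 1 / r)"
        proof -
          have "0 \<le> (r - 1)\<^sup>2 / r" using r0 by simp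
          also have "(r - 1)\<^sup>2 / r = r - 2 + 1 / r"
            using r0 by (simp add: power2_eq_square field_simps)
          finally show ?thesis using M by simp
        qed
        have "\<bar>log_weight (ln a) * (u * f u) - \<kappa>\<bar> \<le> e + M * (r - 2 + 1 / r)"
        proof (cases "r < 1 / 2 \<or> r > 3 / 2")
          case True
          from outer[OF u this r_def] e show ?thesis by simp
        next
          case False
          with central[OF u] nn show ?thesis by (auto simp: r_def)
        qed
        then have "\<bar>log_weight (ln a) * (u * f u) - \<kappa>\<bar> * gamma_dens a b u \<le> (e + M * (r - 2 + 1 / r)) * gamma_dens a b u"
          using a by (intro mult_right_mono gamma_dens_nonneg) auto
        also have "\<dots> = e * gamma_dens a b u + M * (r * gamma_dens a b u - 2 * gamma_dens a b u + 1 / r * gamma_dens a b u)"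
          by (simp only: distrib_left distrib_right left_diff_distrib right_diff_distrib mult.assoc)
        also have "r * gamma_dens a b u = gamma_dens (a + 1) b u"
          unfolding r_def using a b by (intro gamma_dens_mult) auto
        also have "1 / r * gamma_dens a b u = a / (a - 1) * gamma_dens (a - 1) b u"
          unfolding r_def using a b by (intro gamma_dens_divide) auto
        also have "\<bar>log_weight (ln a) * (u * f u) - \<kappa>\<bar> * gamma_dens a b u
            = \<bar>(log_weight (ln a) * (u * f u) - \<kappa>) * gamma_dens a b u\<bar>"
          using gamma_dens_nonneg[of a b u] a by (simp add: abs_mult)
        also have "(log_weight (ln a) * (u * f u) - \<kappa>) * gamma_dens a b u
            = log_weight (ln a) * (u * f u * gamma_dens a b u) - \<kappa> * gamma_dens a b u"
          by (simp only: left_diff_distrib mult.assoc)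
        finally show ?thesis .
      qed (simp add: gamma_dens_def)
      have ig: "integrable lborel (gamma_dens a b)" "integrable lborel (gamma_dens (a + 1) b)" "integrable lborel (gamma_dens (a - 1) b)"
        using a b by (auto intro!: gamma_dens_integrable)
      have it: "integrable lborel (\<lambda>u. log_weight (ln a) * (u * f u * gamma_dens a b u) - \<kappa> * gamma_dens a b u)"
        using a b by (intro Bochner_Integration.integrable_diff integrable_mult_right tail_integrable ig) auto
      have "real y * log_weight (ln (real y)) * poisson_mixture f y b - \<kappa>
          = log_weight (ln a) * (real y * poisson_mixture f y b) - \<kappa>"
        by (simp add: a_def)
      also have "\<dots> = log_weight (ln a) * (LINT u|lborel. u * f u * gamma_dens a b u) - \<kappa> * integral\<^sup>L lborel (gamma_dens a b)"
        using mixture_eq[of y b] elim(4) b a by (simp add: a_def[symmetric] gamma_dens_integral)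
      also have "\<dots> = (LINT u|lborel. log_weight (ln a) * (u * f u * gamma_dens a b u) - \<kappa> * gamma_dens a b u)"
        using ig tail_integrable[of a b] a b
        by (subst Bochner_Integration.integral_diff) (auto intro!: integrable_mult_right)
      finally have "\<bar>real y * log_weight (ln (real y)) * poisson_mixture f y b - \<kappa>\<bar>
          = \<bar>LINT u|lborel. log_weight (ln a) * (u * f u * gamma_dens a b u) - \<kappa> * gamma_dens a b u\<bar>" by simp
      also have "\<dots> \<le> (LINT u|lborel. \<bar>log_weight (ln a) * (u * f u * gamma_dens a b u) - \<kappa> * gamma_dens a b u\<bar>)"
        by (rule integral_abs_bound)
      also have "\<dots> \<le> integral\<^sup>L lborel ?h"
        using it ig pointwise by (intro integral_mono) auto
      also have "\<dots> = e + M * (1 - 2 + a / (a - 1))"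
        using ig a b by (simp add: gamma_dens_integral)
      also have "1 - 2 + a / (a - 1) = 1 / (a - 1)" using a by (simp add: field_simps)
      also have "e + M * (1 / (a - 1)) < 2 * e" using elim(3) by (simp add: a_def)
      finally show ?case .
    qed
  qed
  note * = this
  show ?thesis
  proof (rule tendstoI)
    fix e :: real assume "e > 0"
    then show "eventually (\<lambda>y. dist (real y * log_weight (ln (real y)) * poisson_mixture f y b) \<kappa> < e) sequentially"
      using *[of "e / 2"] by (simp add: dist_real_def)
  qed
qed

end

subsection \<open>The mixing density of the model\<close>

lemma H_dens_measurable [measurable]: "H_dens \<in> borel_measurable borel"
  unfolding H_dens_def by measurable

lemma mix_dens_measurable [measurable]: "mix_dens s \<alpha> \<in> borel_measurable borel"
  unfolding mix_dens_def by measurable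

lemma mix_dens_pos:
  assumes "0 < s" "s < 1" "\<alpha> \<ge> 1" "u > 0"
  shows "mix_dens s \<alpha> u > 0"
proof -
  have "gamma_dens \<alpha> \<alpha> u \<ge> 0" using assms by (intro gamma_dens_nonneg) auto
  moreover have "H_dens u > 0" using assms
    by (auto simp: H_dens_def intro!: divide_pos_pos mult_pos_pos add_pos_pos)
  ultimately show ?thesis using assms by (simp add: mix_dens_def add_nonneg_pos)
qed

text \<open>The exponential factor beats the logarithm at infinity and
  \<open>u powr \<alpha>\<close> beats it at 0, so the gamma component leaves no trace in the tail
  constant.\<close>

lemma gamma_dens_tail:
  assumes "\<alpha> \<ge> 1"
  shows "continuous_on {0<..} (\<lambda>u. u * gamma_dens \<alpha> \<alpha> u * log_weight (ln u))"
    and "((\<lambda>u. u * gamma_dens \<alpha> \<alpha> u * log_weight (ln u)) \<longlongrightarrow> 0) at_top"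
    and "((\<lambda>u. u * gamma_dens \<alpha> \<alpha> u * log_weight (ln u)) \<longlongrightarrow> 0) (at_right 0)"
proof -
  define c where "c = \<alpha> powr \<alpha> / Gamma \<alpha>"
  have a: "\<alpha> > 0" using assms by simp
  have eq: "u * gamma_dens \<alpha> \<alpha> u = u powr \<alpha> * exp (- \<alpha> * u) * c" if "u > 0" for u
    using that by (simp add: gamma_dens_def c_def powr_diff)
  have "continuous_on {0<..} (\<lambda>u. u powr \<alpha> * exp (- \<alpha> * u) * c * log_weight (ln u))"
    unfolding log_weight_def by (intro continuous_intros) auto
  then show "continuous_on {0<..} (\<lambda>u. u * gamma_dens \<alpha> \<alpha> u * log_weight (ln u))"
    by (subst continuous_on_cong[OF refl, of _ _ "\<lambda>u. u powr \<alpha> * exp (- \<alpha> * u) * c * log_weight (ln u)"])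
      (auto simp: eq)
  show "((\<lambda>u. u * gamma_dens \<alpha> \<alpha> u * log_weight (ln u)) \<longlongrightarrow> 0) at_top"
  proof (rule Lim_transform_eventually)
    show "((\<lambda>u. u powr \<alpha> * exp (- \<alpha> * u) * c * (1 + ln u) powr (3 / 2)) \<longlongrightarrow> 0) at_top"
      using a by real_asymp
    show "eventually (\<lambda>u. u powr \<alpha> * exp (- \<alpha> * u) * c * (1 + ln u) powr (3 / 2) =
        u * gamma_dens \<alpha> \<alpha> u * log_weight (ln u)) at_top"
      using eventually_ge_at_top[of 1] by eventually_elim (simp add: eq log_weight_def)
  qed
  show "((\<lambda>u. u * gamma_dens \<alpha> \<alpha> u * log_weight (ln u)) \<longlongrightarrow> 0) (at_right 0)"
  proof (rule Lim_transform_eventually)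
    show "((\<lambda>u. u powr \<alpha> * exp (- \<alpha> * u) * c * (1 - ln u) powr (3 / 2)) \<longlongrightarrow> 0) (at_right 0)"
      using a by real_asymp
    show "eventually (\<lambda>u. u powr \<alpha> * exp (- \<alpha> * u) * c * (1 - ln u) powr (3 / 2) =
        u * gamma_dens \<alpha> \<alpha> u * log_weight (ln u)) (at_right 0)"
      unfolding eventually_at_right_field by (intro exI[of _ 1]) (auto simp: eq log_weight_def)
  qed
qed

text \<open>At infinity the half power and the linear factor of the logarithm combine to the
  exponent 3/2 of the weight. At 0, \<open>u * H_dens u\<close> is of order \<open>sqrt u\<close>,
  which beats the logarithm.\<close>

lemma H_dens_tail:
  shows "continuous_on {0<..} (\<lambda>u. u * H_dens u * log_weight (ln u))"
    and "((\<lambda>u. u * H_dens u * log_weight (ln u)) \<longlongrightarrow> 1 / pi) at_top"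
    and "((\<lambda>u. u * H_dens u * log_weight (ln u)) \<longlongrightarrow> 0) (at_right 0)"
proof -
  define h where "h u = u * (ln (1 + u)) powr (- 1 / 2) / ((1 + u) * (1 + ln (1 + u))) * (1 / pi)" for u :: real
  have eq: "u * H_dens u = h u" if "u > 0" for u
    using that by (simp add: H_dens_def h_def)
  have "continuous_on {0<..} (\<lambda>u. h u * log_weight (ln u))"
    unfolding log_weight_def h_def
    by (intro continuous_intros) (auto simp: add_nonneg_eq_0_iff)
  then show "continuous_on {0<..} (\<lambda>u. u * H_dens u * log_weight (ln u))"
    by (subst continuous_on_cong[OF refl, of _ _ "\<lambda>u. h u * log_weight (ln u)"]) (auto simp: eq)
  show "((\<lambda>u. u * H_dens u * log_weight (ln u)) \<longlongrightarrow> 1 / pi) at_top"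
  proof (rule Lim_transform_eventually)
    have "((\<lambda>u. u * (ln (1 + u)) powr (- 1 / 2) / ((1 + u) * (1 + ln (1 + u))) * (1 + ln u) powr (3 / 2)) \<longlongrightarrow> (1::real)) at_top"
      by real_asymp
    from tendsto_mult[OF this tendsto_const[of "1 / pi"]]
    show "((\<lambda>u. h u * (1 + ln u) powr (3 / 2)) \<longlongrightarrow> 1 / pi) at_top"
      unfolding h_def by (simp add: mult_ac)
    show "eventually (\<lambda>u. h u * (1 + ln u) powr (3 / 2) = u * H_dens u * log_weight (ln u)) at_top"
      using eventually_ge_at_top[of 1] by eventually_elim (simp add: eq log_weight_def)
  qed
  show "((\<lambda>u. u * H_dens u * log_weight (ln u)) \<longlongrightarrow> 0) (at_right 0)"
  proof (rule Lim_transform_eventually)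
    have "((\<lambda>u. u * (ln (1 + u)) powr (- 1 / 2) / ((1 + u) * (1 + ln (1 + u))) * (1 - ln u) powr (3 / 2)) \<longlongrightarrow> (0::real)) (at_right 0)"
      by real_asymp
    from tendsto_mult[OF this tendsto_const[of "1 / pi"]]
    show "((\<lambda>u. h u * (1 - ln u) powr (3 / 2)) \<longlongrightarrow> 0) (at_right 0)"
      unfolding h_def by (simp add: mult_ac)
    show "eventually (\<lambda>u. h u * (1 - ln u) powr (3 / 2) = u * H_dens u * log_weight (ln u)) (at_right 0)"
      unfolding eventually_at_right_field by (intro exI[of _ 1]) (auto simp: eq log_weight_def)
  qed
qed

text \<open>In the variable \<open>ln u\<close> the integrand is
  \<open>(1 + \<bar>t\<bar>) powr (- 3 / 2)\<close>. The antiderivative is elementary on either side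
  of 1, where the absolute value resolves, and has finite limits at the ends. This function
  dominates the mixing density.\<close>

lemma inverse_log_weight_integrable:
  "set_integrable lborel {0<..} (\<lambda>u. 1 / (u * log_weight (ln u)))"
proof -
  have 1: "set_integrable lborel (einterval 0 1) (\<lambda>u. 1 / (u * (1 - ln u) powr (3 / 2)))"
  proof (rule interval_integral_FTC_nonneg(1))
    show "DERIV (\<lambda>u. 2 * (1 - ln u) powr (- 1 / 2)) x :> 1 / (x * (1 - ln x) powr (3 / 2))"
      if "0 < ereal x" "ereal x < 1" for x
    proof -
      have x: "0 < x" "x < 1" using that by (auto simp: zero_ereal_def one_ereal_def)
      have "1 - ln x > 0" using x ln_less_zero[of x] by linarith
      \<comment> \<open>Splitting into half powers matches the shape in which differentiation
        returns the exponent \<open>- 1 / 2 - 1\<close>.\<close>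
      moreover have "(1 - ln x) powr (3 / 2) = (1 - ln x) powr (1 / 2) * ((1 - ln x) powr (1 / 2) * (1 - ln x) powr (1 / 2))"
        unfolding powr_add[symmetric] by simp
      ultimately show ?thesis using x
        by (auto intro!: derivative_eq_intros simp: powr_minus powr_diff divide_simps)
    qed
    show "isCont (\<lambda>u. 1 / (u * (1 - ln u) powr (3 / 2))) x" if "0 < ereal x" "ereal x < 1" for x
    proof -
      have x: "0 < x" "x < 1" using that by (auto simp: zero_ereal_def one_ereal_def)
      have "1 - ln x > 0" using x ln_less_zero[of x] by linarith
      then show ?thesis using x by (intro continuous_intros) auto
    qed
    show "AE x in lborel. 0 < ereal x \<longrightarrow> ereal x < 1 \<longrightarrow> 0 \<le> 1 / (x * (1 - ln x) powr (3 / 2))"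
      by (intro AE_I2) (auto simp: zero_ereal_def)
    have "((\<lambda>u::real. 2 * (1 - ln u) powr (- 1 / 2)) \<longlongrightarrow> 0) (at_right 0)" by real_asymp
    then show "(((\<lambda>u. 2 * (1 - ln u) powr (- 1 / 2)) \<circ> real_of_ereal) \<longlongrightarrow> 0) (at_right 0)"
      by (simp add: zero_ereal_def ereal_tendsto_simps)
    have "((\<lambda>u::real. 2 * (1 - ln u) powr (- 1 / 2)) \<longlongrightarrow> 2) (at_left 1)" by real_asymp
    then show "(((\<lambda>u. 2 * (1 - ln u) powr (- 1 / 2)) \<circ> real_of_ereal) \<longlongrightarrow> 2) (at_left 1)"
      by (simp add: one_ereal_def ereal_tendsto_simps)
  qed simp
  have 2: "set_integrable lborel (einterval 1 \<infinity>) (\<lambda>u. 1 / (u * (1 + ln u) powr (3 / 2)))"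
  proof (rule interval_integral_FTC_nonneg(1))
    show "DERIV (\<lambda>u. - 2 * (1 + ln u) powr (- 1 / 2)) x :> 1 / (x * (1 + ln x) powr (3 / 2))"
      if "1 < ereal x" "ereal x < \<infinity>" for x
    proof -
      have x: "1 < x" using that by (auto simp: one_ereal_def)
      have "1 + ln x > 0" using x ln_gt_zero[of x] by linarith
      moreover have "(1 + ln x) powr (3 / 2) = (1 + ln x) powr (1 / 2) * ((1 + ln x) powr (1 / 2) * (1 + ln x) powr (1 / 2))"
        unfolding powr_add[symmetric] by simp
      ultimately show ?thesis using x
        by (auto intro!: derivative_eq_intros simp: powr_minus powr_diff divide_simps)
    qed
    show "isCont (\<lambda>u. 1 / (u * (1 + ln u) powr (3 / 2))) x" if "1 < ereal x" "ereal x < \<infinity>" for x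
    proof -
      have x: "1 < x" using that by (auto simp: one_ereal_def)
      have "1 + ln x > 0" using x ln_gt_zero[of x] by linarith
      then show ?thesis using x by (intro continuous_intros) auto
    qed
    show "AE x in lborel. 1 < ereal x \<longrightarrow> ereal x < \<infinity> \<longrightarrow> 0 \<le> 1 / (x * (1 + ln x) powr (3 / 2))"
      by (intro AE_I2) (auto simp: one_ereal_def)
    have "((\<lambda>u::real. - 2 * (1 + ln u) powr (- 1 / 2)) \<longlongrightarrow> -2) (at_right 1)" by real_asymp
    then show "(((\<lambda>u. - 2 * (1 + ln u) powr (- 1 / 2)) \<circ> real_of_ereal) \<longlongrightarrow> -2) (at_right 1)"
      by (simp add: one_ereal_def ereal_tendsto_simps)
    have "((\<lambda>u::real. - 2 * (1 + ln u) powr (- 1 / 2)) \<longlongrightarrow> 0) at_top" by real_asymp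
    then show "(((\<lambda>u. - 2 * (1 + ln u) powr (- 1 / 2)) \<circ> real_of_ereal) \<longlongrightarrow> 0) (at_left \<infinity>)"
      by (simp add: ereal_tendsto_simps)
  qed simp
  let ?w = "\<lambda>u. 1 / (u * log_weight (ln u))"
  have e: "einterval 0 1 = {0<..<1}" "einterval 1 \<infinity> = {1<..}"
    by (auto simp: einterval_def zero_ereal_def one_ereal_def)
  have "set_integrable lborel {0<..<1} ?w"
    using 1 unfolding e set_integrable_def
    by (rule Bochner_Integration.integrable_cong[THEN iffD1, rotated 2])
      (auto simp: indicator_def log_weight_def)
  moreover have "set_integrable lborel {1<..} ?w"
    using 2 unfolding e set_integrable_def
    by (rule Bochner_Integration.integrable_cong[THEN iffD1, rotated 2])
      (auto simp: indicator_def log_weight_def)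
  ultimately have "set_integrable lborel ({0<..<1} \<union> {1<..}) ?w"
    by (rule set_integrable_Un) auto
  \<comment> \<open>The two open intervals miss only the null point 1.\<close>
  then show ?thesis
    unfolding set_integrable_def
    by (rule integrable_cong_AE_imp)
      (use AE_lborel_singleton[of 1] in \<open>auto elim!: eventually_mono simp: indicator_def\<close>)
qed

text \<open>The tail constant is the weight \<open>s\<close> times the limit \<open>1 / pi\<close>
  of the \<open>H_dens\<close> part. Integrability follows from the pointwise bound, which places
  the density below a multiple of \<open>1 / (u * log_weight (ln u))\<close>.\<close>

lemma mix_dens_log_regular:
  assumes "0 < s" "s < 1" "\<alpha> \<ge> 1"
  shows "\<exists>C. log_regular_density (mix_dens s \<alpha>) (s / pi) C"
proof -
  let ?f = "mix_dens s \<alpha>"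
  let ?F = "\<lambda>u. u * ?f u * log_weight (ln u)"
  have F: "?F = (\<lambda>u. (1 - s) * (u * gamma_dens \<alpha> \<alpha> u * log_weight (ln u)) + s * (u * H_dens u * log_weight (ln u)))"
    by (auto simp: mix_dens_def algebra_simps)
  have lim: "(?F \<longlongrightarrow> (1 - s) * 0 + s * (1 / pi)) at_top"
    unfolding F by (intro tendsto_intros gamma_dens_tail H_dens_tail assms)
  have "\<exists>C>0. \<forall>u>0. ?F u \<le> C"
  proof (rule bounded_above_on_pos_reals)
    show "continuous_on {0<..} ?F"
      unfolding F by (intro continuous_intros gamma_dens_tail H_dens_tail assms)
    show "(?F \<longlongrightarrow> (1 - s) * 0 + s * 0) (at_right 0)"
      unfolding F by (intro tendsto_intros gamma_dens_tail H_dens_tail assms)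
  qed (rule lim)
  then obtain C where C: "\<And>u. u > 0 \<Longrightarrow> ?F u \<le> C" by auto
  have "log_regular_density ?f (s / pi) C"
  proof
    show "set_integrable lborel {0<..} ?f"
    proof (rule set_integrable_bound)
      show "set_integrable lborel {0<..} (\<lambda>u. C * (1 / (u * log_weight (ln u))))"
        by (intro set_integrable_mult_right inverse_log_weight_integrable)
      show "AE u in lborel. u \<in> {0<..} \<longrightarrow> norm (?f u) \<le> norm (C * (1 / (u * log_weight (ln u))))"
      proof (intro AE_I2 impI)
        fix u :: real assume "u \<in> {0<..}"
        then have u: "u > 0" by simp
        have "?f u \<le> C * (1 / (u * log_weight (ln u)))"
          using C[OF u] u log_weight_pos[of "ln u"] by (simp add: field_simps)
        then show "norm (?f u) \<le> norm (C * (1 / (u * log_weight (ln u))))"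
          using mix_dens_pos[OF assms u] unfolding real_norm_def by linarith
      qed
    qed (simp add: set_borel_measurable_def)
  qed (use C lim mix_dens_pos[OF assms] in auto)
  then show ?thesis ..
qed

subsection \<open>Covariates in general position\<close>

text \<open>The sum of \<open>\<bar>x i \<bullet> v\<bar>\<close> is positive off 0, since a vector
  orthogonal to a spanning set is 0. Its minimum \<open>m\<close> on the unit sphere is therefore
  positive, and some summand reaches the average \<open>m / card J\<close>.\<close>

lemma spanning_sup_bound:
  fixes x :: "'n \<Rightarrow> real^'p"
  assumes "finite J" "span (x ` J) = UNIV"
  shows "\<exists>c>0. \<forall>v. \<exists>i\<in>J. \<bar>x i \<bullet> v\<bar> \<ge> c * norm v"
proof -
  define N where "N v = (\<Sum>i\<in>J. \<bar>x i \<bullet> v\<bar>)" for v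
  have N_pos: "N v > 0" if "v \<noteq> 0" for v
  proof -
    have "\<exists>i\<in>J. x i \<bullet> v \<noteq> 0"
    proof (rule ccontr)
      assume "\<not> ?thesis"
      then have "orthogonal v w" if "w \<in> x ` J" for w
        using that by (auto simp: orthogonal_def inner_commute)
      then have "orthogonal v v"
        using orthogonal_to_span[of v "x ` J" v] assms(2) by auto
      with that show False by (simp add: orthogonal_def)
    qed
    then show ?thesis unfolding N_def by (auto intro!: sum_pos2[OF assms(1)])
  qed
  have "compact (sphere (0::real^'p) 1)" "sphere (0::real^'p) 1 \<noteq> {}" by auto
  moreover have "continuous_on (sphere 0 1) N"
    unfolding N_def by (intro continuous_intros)
  ultimately obtain v0 where v0: "v0 \<in> sphere 0 1" "\<And>v. v \<in> sphere 0 1 \<Longrightarrow> N v0 \<le> N v"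
    by (metis continuous_attains_inf)
  define m where "m = N v0"
  have m: "m > 0" unfolding m_def using v0(1) by (intro N_pos) auto
  have J: "card J > 0"
  proof (rule ccontr)
    assume "\<not> ?thesis"
    with assms(1) have "J = {}" by simp
    with m show False by (simp add: m_def N_def)
  qed
  have lower: "m * norm v \<le> N v" for v
  proof (cases "v = 0")
    case False
    have "m \<le> N (v /\<^sub>R norm v)" unfolding m_def using False by (intro v0(2)) auto
    also have "\<dots> = N v / norm v"
      by (simp add: N_def abs_mult sum_divide_distrib divide_inverse mult.commute sum_distrib_left)
    finally show ?thesis using False by (simp add: field_simps)
  qed (simp add: N_def)
  show ?thesis
  proof (intro exI[of _ "m / card J"] conjI allI)
    show "m / card J > 0" using m J by simp
    fix v
    show "\<exists>i\<in>J. \<bar>x i \<bullet> v\<bar> \<ge> m / card J * norm v"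
    proof (rule ccontr)
      assume "\<not> ?thesis"
      then have "N v < (\<Sum>i\<in>J. m / card J * norm v)"
        unfolding N_def using J assms(1) by (intro sum_strict_mono) (auto simp: not_le)
      also have "\<dots> = m * norm v" using J by simp
      finally show False using lower[of v] by simp
    qed
  qed
qed

text \<open>Every set of \<open>CARD('p)\<close> indices yields a basis and thus a constant from
  \<open>spanning_sup_bound\<close>. With the least of these constants, \<open>CARD('p)\<close>
  simultaneously small inner products are impossible.\<close>

lemma general_position_bound:
  fixes x :: "'n \<Rightarrow> real^'p"
  assumes "finite I" and gp: "\<And>J. J \<subseteq> I \<Longrightarrow> card J = CARD('p) \<Longrightarrow> inj_on x J \<and> independent (x ` J)"
  shows "\<exists>c>0. \<forall>v. card {i \<in> I. \<bar>x i \<bullet> v\<bar> < c * norm v} < CARD('p)"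
proof -
  define \<J> where "\<J> = {J. J \<subseteq> I \<and> card J = CARD('p)}"
  have fin: "finite \<J>" unfolding \<J>_def using assms(1) by simp
  have "\<exists>c>0. \<forall>v. \<exists>i\<in>J. \<bar>x i \<bullet> v\<bar> \<ge> c * norm v" if "J \<in> \<J>" for J
  proof (rule spanning_sup_bound)
    have J: "J \<subseteq> I" "card J = CARD('p)" using that by (auto simp: \<J>_def)
    then show "finite J" using assms(1) finite_subset by blast
    have "inj_on x J" "independent (x ` J)" using gp[OF J] by auto
    moreover from this J have "card (x ` J) = DIM(real^'p)" by (simp add: card_image)
    ultimately show "span (x ` J) = UNIV"
      by (metis dim_eq_card_independent dim_eq_full)
  qed
  then obtain c where c: "\<And>J. J \<in> \<J> \<Longrightarrow> c J > 0" "\<And>J v. J \<in> \<J> \<Longrightarrow> \<exists>i\<in>J. \<bar>x i \<bullet> v\<bar> \<ge> c J * norm v"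
    by metis
  \<comment> \<open>The inserted 1 keeps the minimum meaningful when \<open>I\<close> has fewer than
    \<open>CARD('p)\<close> elements.\<close>
  define c0 where "c0 = Min (insert 1 (c ` \<J>))"
  have c0: "c0 > 0" "\<And>J. J \<in> \<J> \<Longrightarrow> c0 \<le> c J"
    unfolding c0_def using fin c(1) by auto
  have "card {i \<in> I. \<bar>x i \<bullet> v\<bar> < c0 * norm v} < CARD('p)" for v
  proof (rule ccontr)
    assume "\<not> ?thesis"
    then have "CARD('p) \<le> card {i \<in> I. \<bar>x i \<bullet> v\<bar> < c0 * norm v}" by simp
    then obtain J where J: "J \<subseteq> {i \<in> I. \<bar>x i \<bullet> v\<bar> < c0 * norm v}" "card J = CARD('p)"
      by (rule obtain_subset_with_card_n)
    then have "J \<in> \<J>" by (auto simp: \<J>_def)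
    then obtain i where "i \<in> J" "\<bar>x i \<bullet> v\<bar> \<ge> c J * norm v" using c(2) by blast
    moreover have "c0 * norm v \<le> c J * norm v" using c0(2)[OF \<open>J \<in> \<J>\<close>] by (intro mult_right_mono) auto
    ultimately show False using J(1) by fastforce
  qed
  with c0(1) show ?thesis by auto
qed

text \<open>Each factor over \<open>L\<close> grows at most like the weight of
  \<open>norm \<beta>\<close>, and at least \<open>card L\<close> factors over \<open>I\<close> grow
  at that rate. Matching them cancels the dependence on \<open>\<beta>\<close>, leaving a polynomial
  in \<open>norm \<xi>\<close>.\<close>

lemma log_weight_prod_ratio:
  fixes x :: "'n::finite \<Rightarrow> real^'p" and g :: "'n \<Rightarrow> real^'q" and I L :: "'n set"
  assumes card: "card L + CARD('p) \<le> card I + 1"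
    and gp: "\<And>J. J \<subseteq> I \<Longrightarrow> card J = CARD('p) \<Longrightarrow> inj_on x J \<and> independent (x ` J)"
  shows "\<exists>R>0. \<forall>\<beta> (\<xi>::real^'q^'n).
    (\<Prod>i\<in>L. log_weight (x i \<bullet> \<beta> + g i \<bullet> (\<xi> $ i)))
    \<le> R * (1 + norm \<xi>) ^ (3 * card L) * (\<Prod>i\<in>I. log_weight (x i \<bullet> \<beta> + g i \<bullet> (\<xi> $ i)))"
proof -
  obtain c where c: "c > 0" "\<And>v. card {i \<in> I. \<bar>x i \<bullet> v\<bar> < c * norm v} < CARD('p)"
    using general_position_bound[OF finite gp] by blast
  \<comment> \<open>The cap at 1 gives
    \<open>c' * (1 + norm \<beta>) \<le> 1 + c * norm \<beta>\<close>.\<close>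
  define c' where "c' = min 1 c"
  have c': "c' > 0" "c' \<le> 1" "c' \<le> c" using c(1) by (auto simp: c'_def)
  define a where "a = 1 + (\<Sum>i\<in>UNIV. norm (x i) + norm (g i))"
  have le_a: "1 + norm (x i) \<le> a" "1 + norm (g i) \<le> a" for i
  proof -
    have "norm (x i) + norm (g i) \<le> (\<Sum>i\<in>UNIV. norm (x i) + norm (g i))"
      by (rule member_le_sum) auto
    then show "1 + norm (x i) \<le> a" "1 + norm (g i) \<le> a"
      unfolding a_def using norm_ge_zero[of "x i"] norm_ge_zero[of "g i"] by linarith+
  qed
  have a: "a \<ge> 1" unfolding a_def by (simp add: sum_nonneg)
  define l where "l = card L"
  define R where "R = (a ^ 3 / c') ^ l"
  have R: "R > 0" using a c' by (simp add: R_def)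
  have "(\<Prod>i\<in>L. log_weight (x i \<bullet> \<beta> + g i \<bullet> (\<xi> $ i)))
      \<le> R powr (3 / 2) * (1 + norm \<xi>) ^ (3 * l) * (\<Prod>i\<in>I. log_weight (x i \<bullet> \<beta> + g i \<bullet> (\<xi> $ i)))"
    for \<beta> and \<xi> :: "real^'q^'n"
  proof -
    define P where "P i = 1 + \<bar>x i \<bullet> \<beta> + g i \<bullet> (\<xi> $ i)\<bar>" for i
    define X where "X = 1 + norm \<beta>"
    define Y where "Y = 1 + norm \<xi>"
    have XY: "X \<ge> 1" "Y \<ge> 1" by (auto simp: X_def Y_def)
    have P: "P i \<ge> 1" for i by (simp add: P_def)
    have x_le: "1 + \<bar>x i \<bullet> \<beta>\<bar> \<le> a * X" for i
    proof -
      have "1 + \<bar>x i \<bullet> \<beta>\<bar> \<le> 1 + norm (x i) * norm \<beta>" by (simp add: Cauchy_Schwarz_ineq2)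
      also have "\<dots> \<le> (1 + norm (x i)) * X" by (simp add: X_def algebra_simps)
      also have "\<dots> \<le> a * X" using le_a(1)[of i] XY by (intro mult_right_mono) auto
      finally show ?thesis .
    qed
    have g_le: "1 + \<bar>g i \<bullet> (\<xi> $ i)\<bar> \<le> a * Y" for i
    proof -
      have "\<bar>g i \<bullet> (\<xi> $ i)\<bar> \<le> norm (g i) * norm (\<xi> $ i)" by (rule Cauchy_Schwarz_ineq2)
      also have "\<dots> \<le> norm (g i) * norm \<xi>"
        by (intro mult_left_mono Finite_Cartesian_Product.norm_nth_le) auto
      finally have "\<bar>g i \<bullet> (\<xi> $ i)\<bar> \<le> norm (g i) * norm \<xi>" .
      moreover have "(1 + norm (g i)) * Y = 1 + norm (g i) * norm \<xi> + (norm (g i) + norm \<xi>)"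
        by (simp add: Y_def algebra_simps)
      ultimately have "1 + \<bar>g i \<bullet> (\<xi> $ i)\<bar> \<le> (1 + norm (g i)) * Y"
        using norm_ge_zero[of "g i"] norm_ge_zero[of \<xi>] by linarith
      also have "\<dots> \<le> a * Y" using le_a(2)[of i] XY by (intro mult_right_mono) auto
      finally show ?thesis .
    qed
    have "P i \<le> a\<^sup>2 * X * Y" for i
    proof -
      have "P i \<le> (1 + \<bar>x i \<bullet> \<beta>\<bar>) * (1 + \<bar>g i \<bullet> (\<xi> $ i)\<bar>)" unfolding P_def by (rule one_plus_abs_add_le)
      also have "\<dots> \<le> (a * X) * (a * Y)" using a XY by (intro mult_mono x_le g_le) auto
      finally show ?thesis by (simp add: power2_eq_square mult_ac)
    qed
    then have "(\<Prod>i\<in>L. P i) \<le> (\<Prod>i\<in>L. a\<^sup>2 * X * Y)"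
      using P by (intro prod_mono) (auto intro: order_trans[OF zero_le_one])
    then have upper: "(\<Prod>i\<in>L. P i) \<le> (a\<^sup>2 * X * Y) ^ l" by (simp add: l_def)
    define G0 where "G0 = I - {i \<in> I. \<bar>x i \<bullet> \<beta>\<bar> < c * norm \<beta>}"
    \<comment> \<open>At most \<open>CARD('p) - 1\<close> indices are removed; this is the 1 that
      appears in the cardinality condition.\<close>
    have "card G0 = card I - card {i \<in> I. \<bar>x i \<bullet> \<beta>\<bar> < c * norm \<beta>}"
      unfolding G0_def by (rule card_Diff_subset) auto
    with c(2)[of \<beta>] card have "l \<le> card G0" unfolding l_def by linarith
    then obtain G where G: "G \<subseteq> G0" "card G = l" by (rule obtain_subset_with_card_n)
    have GI: "G \<subseteq> I" using G(1) by (auto simp: G0_def)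
    have "c' * X / (a * Y) \<le> P i" if "i \<in> G" for i
    proof -
      have "c * norm \<beta> \<le> \<bar>x i \<bullet> \<beta>\<bar>" using that G(1) by (auto simp: G0_def)
      moreover have "c' * norm \<beta> \<le> c * norm \<beta>" using c' by (intro mult_right_mono) auto
      ultimately have "c' * X \<le> 1 + \<bar>x i \<bullet> \<beta>\<bar>" using c' by (simp add: X_def distrib_left)
      \<comment> \<open>The lower bound on \<open>P i\<close> comes from submultiplicativity read
        backwards: \<open>x i \<bullet> \<beta>\<close> is the linear predictor minus its random
        effect.\<close>
      also have "\<dots> \<le> P i * (1 + \<bar>g i \<bullet> (\<xi> $ i)\<bar>)"
        unfolding P_def using one_plus_abs_add_le[of "x i \<bullet> \<beta> + g i \<bullet> (\<xi> $ i)" "- (g i \<bullet> (\<xi> $ i))"] by simp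
      also have "\<dots> \<le> P i * (a * Y)" using P[of i] by (intro mult_left_mono g_le) auto
      finally show ?thesis using a XY by (simp add: pos_divide_le_eq)
    qed
    then have "(\<Prod>i\<in>G. c' * X / (a * Y)) \<le> (\<Prod>i\<in>G. P i)"
      using c' a XY by (intro prod_mono) auto
    also have "(\<Prod>i\<in>G. P i) \<le> (\<Prod>i\<in>I. P i)"
    proof -
      have "(\<Prod>i\<in>G. P i) * 1 \<le> (\<Prod>i\<in>G. P i) * (\<Prod>i\<in>I - G. P i)"
        using P by (intro mult_left_mono prod_ge_1 prod_nonneg) (auto intro: order_trans[OF zero_le_one])
      also have "\<dots> = (\<Prod>i\<in>I. P i)" using prod.subset_diff[OF GI, of P] by (simp add: mult.commute)
      finally show ?thesis by simp
    qed
    finally have lower: "(c' * X / (a * Y)) ^ l \<le> (\<Prod>i\<in>I. P i)" using G by simp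
    \<comment> \<open>The upper bound is rewritten as a multiple of the lower one. Each matched pair
      costs \<open>Y\<^sup>2\<close>, which the power 3/2 turns into the exponent 3 of the
      statement.\<close>
    have "(a\<^sup>2 * X * Y) ^ l = (a ^ 3 / c' * Y\<^sup>2 * (c' * X / (a * Y))) ^ l"
      using c' a XY by (intro arg_cong[of _ _ "\<lambda>t. t ^ l"]) (simp add: field_simps power2_eq_square power3_eq_cube)
    also have "\<dots> = R * Y ^ (2 * l) * (c' * X / (a * Y)) ^ l"
      by (simp only: R_def power_mult_distrib power_mult)
    also have "\<dots> \<le> R * Y ^ (2 * l) * (\<Prod>i\<in>I. P i)"
      using R XY by (intro mult_left_mono lower) auto
    finally have "(\<Prod>i\<in>L. P i) \<le> R * Y ^ (2 * l) * (\<Prod>i\<in>I. P i)" using upper by linarith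
    then have "(\<Prod>i\<in>L. P i) powr (3 / 2) \<le> (R * Y ^ (2 * l) * (\<Prod>i\<in>I. P i)) powr (3 / 2)"
      using P by (intro powr_mono2 prod_nonneg) (auto intro: order_trans[OF zero_le_one])
    also have "\<dots> = R powr (3 / 2) * (Y ^ (2 * l)) powr (3 / 2) * (\<Prod>i\<in>I. P i) powr (3 / 2)"
      by (simp add: powr_mult)
    also have "(Y ^ (2 * l)) powr (3 / 2) = Y ^ (3 * l)"
      using XY by (simp add: powr_powr flip: powr_realpow)
    finally show ?thesis
      using P by (simp add: log_weight_def P_def Y_def prod_powr_distrib)
  qed
  then show ?thesis using R unfolding l_def by (intro exI[of _ "R powr (3 / 2)"]) auto
qed

subsection \<open>Gaussian moments\<close>

lemma linear_flatten: "linear flatten"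
  by (rule linearI) (auto simp: flatten_def vec_eq_iff)

lemma flatten_eq_0_iff: "flatten v = 0 \<longleftrightarrow> v = 0"
  by (auto simp: flatten_def vec_eq_iff)

lemma flatten_diff: "flatten v - flatten w = flatten (v - w)"
  by (simp add: flatten_def vec_eq_iff)

lemma continuous_on_flatten [continuous_intros]:
  fixes f :: "'a::euclidean_space \<Rightarrow> real^'q^'n"
  shows "continuous_on A f \<Longrightarrow> continuous_on A (\<lambda>x. flatten (f x))"
  by (rule linear_continuous_on_compose[OF _ linear_flatten])

text \<open>Positive definiteness makes \<open>S\<close> injective, so \<open>matrix_inv S\<close>
  is a genuine inverse. With \<open>w = matrix_inv S *v v\<close> the form equals
  \<open>w \<bullet> (S *v w)\<close>, and \<open>w\<close> is nonzero.\<close>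

lemma matrix_inv_pos_def:
  fixes S :: "real^'d^'d"
  assumes "pos_def_matrix S" "v \<noteq> 0"
  shows "v \<bullet> (matrix_inv S *v v) > 0"
proof -
  have pd: "w \<noteq> 0 \<Longrightarrow> w \<bullet> (S *v w) > 0" for w using assms(1) by (auto simp: pos_def_matrix_def)
  have "inj ((*v) S)"
  proof (rule linear_injective_0[THEN iffD2, OF matrix_vector_mul_linear], intro allI impI)
    fix w assume "S *v w = 0"
    with pd[of w] show "w = 0" by force
  qed
  then have "invertible S"
    by (simp add: invertible_left_inverse matrix_left_invertible_injective)
  then have "S ** matrix_inv S = mat 1"
    unfolding invertible_def matrix_inv_def by (rule someI2_ex) simp
  then have eq: "S *v (matrix_inv S *v v) = v"
    by (simp add: matrix_vector_mul_assoc)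
  with assms(2) have "matrix_inv S *v v \<noteq> 0" by auto
  from pd[OF this] show ?thesis by (simp add: eq inner_commute)
qed

lemma pos_def_quadratic_lower_bound:
  fixes S :: "real^('n \<times> 'q)^('n::finite \<times> 'q::finite)"
  assumes "pos_def_matrix S"
  shows "\<exists>c>0. \<forall>v::real^'q^'n. flatten v \<bullet> (matrix_inv S *v flatten v) \<ge> c * (norm v)\<^sup>2"
proof -
  define Q where "Q v = flatten v \<bullet> (matrix_inv S *v flatten v)" for v :: "real^'q^'n"
  have "compact (sphere (0::real^'q^'n) 1)" "sphere (0::real^'q^'n) 1 \<noteq> {}" by auto
  moreover have "continuous_on (sphere 0 1) Q"
    unfolding Q_def by (intro continuous_intros linear_continuous_on_compose[OF _ matrix_vector_mul_linear])
  ultimately obtain v0 where v0: "v0 \<in> sphere 0 1" "\<And>v. v \<in> sphere 0 1 \<Longrightarrow> Q v0 \<le> Q v"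
    by (metis continuous_attains_inf)
  have "Q v0 > 0" unfolding Q_def using v0(1) by (intro matrix_inv_pos_def assms) (auto simp: flatten_eq_0_iff)
  moreover have "Q v0 * (norm v)\<^sup>2 \<le> Q v" for v
  proof (cases "v = 0")
    case False
    have "flatten (v /\<^sub>R norm v) = flatten v /\<^sub>R norm v"
      by (simp add: linear_cmul[OF linear_flatten])
    then have "Q (v /\<^sub>R norm v) = Q v / (norm v)\<^sup>2"
      by (simp add: Q_def linear_cmul[OF matrix_vector_mul_linear] divide_inverse power2_eq_square mult_ac)
    moreover have "Q v0 \<le> Q (v /\<^sub>R norm v)" using False by (intro v0(2)) auto
    ultimately have "Q v0 \<le> Q v / (norm v)\<^sup>2" by simp
    then show ?thesis using False by (simp add: pos_le_divide_eq)
  qed (simp add: Q_def flatten_eq_0_iff[THEN iffD2, OF refl])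
  ultimately show ?thesis unfolding Q_def by blast
qed

text \<open>The kernel factorises over the coordinates into multiples of normal densities with
  variance \<open>1 / (2 * c)\<close>.\<close>

lemma integrable_gaussian:
  fixes m :: "'a::euclidean_space"
  assumes "c > 0"
  shows "integrable lborel (\<lambda>v. exp (- c * (norm (v - m))\<^sup>2))"
proof -
  have norm2: "(norm v)\<^sup>2 = (\<Sum>b\<in>Basis. (v \<bullet> b)\<^sup>2)" for v :: 'a
    by (subst euclidean_inner[of v v, folded power2_norm_eq_inner]) (simp add: power2_eq_square)
  have one: "(\<integral>\<^sup>+t. ennreal (exp (- c * (t - \<mu>)\<^sup>2)) \<partial>lborel) < \<infinity>" for \<mu> :: real
  proof -
    define \<sigma> where "\<sigma> = sqrt (1 / (2 * c))"
    have s: "\<sigma> > 0" "\<sigma>\<^sup>2 = 1 / (2 * c)" using assms by (auto simp: \<sigma>_def)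
    have "integrable lborel (\<lambda>t. sqrt (2 * pi * \<sigma>\<^sup>2) * normal_density \<mu> \<sigma> t)"
      using s by (intro integrable_mult_right integrable_normal_density) auto
    also have "(\<lambda>t. sqrt (2 * pi * \<sigma>\<^sup>2) * normal_density \<mu> \<sigma> t) = (\<lambda>t. exp (- c * (t - \<mu>)\<^sup>2))"
      using s assms by (auto simp: normal_density_def fun_eq_iff)
    finally show ?thesis by (simp add: integrable_iff_bounded)
  qed
  have "(\<integral>\<^sup>+v. ennreal (exp (- c * (norm (v - m))\<^sup>2)) \<partial>lborel)
      = (\<integral>\<^sup>+v. (\<Prod>b\<in>Basis. ennreal (exp (- c * (v \<bullet> b - m \<bullet> b)\<^sup>2))) \<partial>lborel)"
    by (intro nn_integral_cong)
      (simp add: prod_ennreal norm2 sum_distrib_left exp_sum inner_diff_left sum_negf[symmetric])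
  also have "\<dots> = (\<Prod>b\<in>Basis. (\<integral>\<^sup>+t. ennreal (exp (- c * (t - m \<bullet> b)\<^sup>2)) \<partial>lborel))"
    by (rule nn_integral_lborel_prod) auto
  also have "\<dots> < \<infinity>"
    using one by (simp add: ennreal_prod_eq_top less_top[symmetric])
  finally show ?thesis by (simp add: integrable_iff_bounded)
qed

lemma power_le_exp_square:
  assumes "c > 0"
  shows "\<exists>B>0. \<forall>t\<ge>(0::real). (1 + t) ^ k \<le> B * exp (c * t\<^sup>2)"
proof -
  have "\<exists>B>0. \<forall>t>0. (1 + t) ^ k / exp (c * t\<^sup>2) \<le> B"
  proof (rule bounded_above_on_pos_reals)
    show "((\<lambda>t::real. (1 + t) ^ k / exp (c * t\<^sup>2)) \<longlongrightarrow> 0) at_top"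
      using assms by real_asymp
    show "((\<lambda>t::real. (1 + t) ^ k / exp (c * t\<^sup>2)) \<longlongrightarrow> (1 + 0) ^ k / exp (c * 0\<^sup>2)) (at_right 0)"
      by (intro tendsto_intros) auto
  qed (intro continuous_intros, auto)
  then obtain B where B: "B > 0" "\<And>t. t > 0 \<Longrightarrow> (1 + t) ^ k / exp (c * t\<^sup>2) \<le> B" by auto
  \<comment> \<open>The bound \<open>B\<close> covers positive \<open>t\<close> only; adding 1
    covers \<open>t = 0\<close>, where both powers are 1.\<close>
  have "(1 + t) ^ k \<le> (B + 1) * exp (c * t\<^sup>2)" if "t \<ge> 0" for t
  proof (cases "t = 0")
    case False
    with that B(2)[of t] have "(1 + t) ^ k \<le> B * exp (c * t\<^sup>2)" by (simp add: field_simps)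
    also have "\<dots> \<le> (B + 1) * exp (c * t\<^sup>2)" by (intro mult_right_mono) auto
    finally show ?thesis .
  qed (use B in auto)
  with B(1) show ?thesis by (intro exI[of _ "B + 1"]) auto
qed

text \<open>The normalising factor is left out because it cancels in the posterior; the kernel is
  then positive by its form alone.\<close>

definition gauss_kernel :: "real^'q^'n \<Rightarrow> real^('n \<times> 'q)^('n::finite \<times> 'q::finite) \<Rightarrow> real^'q^'n \<Rightarrow> real" where
  "gauss_kernel m S \<xi> = exp (- (1 / 2) * (flatten (\<xi> - m) \<bullet> (matrix_inv S *v flatten (\<xi> - m))))"

lemma mvn_dens_flatten:
  fixes m :: "real^'q^'n" and S :: "real^('n \<times> 'q)^('n::finite \<times> 'q::finite)"
  shows "mvn_dens (flatten m) S (flatten \<xi>)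
    = 1 / sqrt ((2 * pi) ^ CARD('n \<times> 'q) * det S) * gauss_kernel m S \<xi>"
  by (simp add: mvn_dens_def gauss_kernel_def flatten_diff)

lemma gauss_kernel_measurable [measurable]: "gauss_kernel m S \<in> borel_measurable borel"
  unfolding gauss_kernel_def
  by (intro borel_measurable_continuous_onI continuous_intros
      linear_continuous_on_compose[OF _ matrix_vector_mul_linear])

lemma gauss_kernel_pos: "gauss_kernel m S \<xi> > 0"
  by (simp add: gauss_kernel_def)

lemma gauss_kernel_moment_integrable:
  fixes m :: "real^'q^'n" and S :: "real^('n \<times> 'q)^('n::finite \<times> 'q::finite)"
  assumes "pos_def_matrix S"
  shows "integrable lborel (\<lambda>\<xi>. gauss_kernel m S \<xi> * (1 + norm \<xi>) ^ k)"
proof -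
  obtain c where c: "c > 0" "\<And>v::real^'q^'n. flatten v \<bullet> (matrix_inv S *v flatten v) \<ge> c * (norm v)\<^sup>2"
    using pos_def_quadratic_lower_bound[OF assms] by auto
  \<comment> \<open>The kernel decays like \<open>exp (- (c / 2) * t\<^sup>2)\<close>; half of this
    rate is spent on the polynomial, leaving \<open>c / 4\<close> for integrability.\<close>
  obtain B where B: "B > 0" "\<And>t. t \<ge> 0 \<Longrightarrow> (1 + t) ^ k \<le> B * exp (c / 4 * t\<^sup>2)"
    using power_le_exp_square[of "c / 4" k] c(1) by auto
  show ?thesis
  proof (rule Bochner_Integration.integrable_bound)
    show "integrable lborel (\<lambda>\<xi>. (1 + norm m) ^ k * B * exp (- (c / 4) * (norm (\<xi> - m))\<^sup>2))"
      using c by (intro integrable_mult_right integrable_gaussian) auto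
    show "AE \<xi> in lborel. norm (gauss_kernel m S \<xi> * (1 + norm \<xi>) ^ k)
        \<le> norm ((1 + norm m) ^ k * B * exp (- (c / 4) * (norm (\<xi> - m))\<^sup>2))"
    proof (rule AE_I2)
      fix \<xi> :: "real^'q^'n"
      define t where "t = norm (\<xi> - m)"
      have "norm \<xi> \<le> t + norm m" unfolding t_def using norm_triangle_ineq[of "\<xi> - m" m] by simp
      also have "1 + (t + norm m) \<le> (1 + norm m) * (1 + t)" by (simp add: t_def algebra_simps)
      finally have "(1 + norm \<xi>) ^ k \<le> ((1 + norm m) * (1 + t)) ^ k"
        by (intro power_mono) auto
      also have "\<dots> \<le> (1 + norm m) ^ k * (B * exp (c / 4 * t\<^sup>2))"
        unfolding power_mult_distrib by (intro mult_left_mono B) (auto simp: t_def)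
      finally have 1: "(1 + norm \<xi>) ^ k \<le> (1 + norm m) ^ k * (B * exp (c / 4 * t\<^sup>2))" .
      have 2: "gauss_kernel m S \<xi> \<le> exp (- (c / 2) * t\<^sup>2)"
        using c(2)[of "\<xi> - m"] by (simp add: t_def gauss_kernel_def)
      have "norm (gauss_kernel m S \<xi> * (1 + norm \<xi>) ^ k) = gauss_kernel m S \<xi> * (1 + norm \<xi>) ^ k"
        using gauss_kernel_pos[of m S \<xi>] by (simp add: abs_mult)
      also have "\<dots> \<le> exp (- (c / 2) * t\<^sup>2) * ((1 + norm m) ^ k * (B * exp (c / 4 * t\<^sup>2)))"
        by (intro mult_mono 1 2) auto
      also have "\<dots> = (1 + norm m) ^ k * B * (exp (- (c / 2) * t\<^sup>2) * exp (c / 4 * t\<^sup>2))" by simp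
      also have "exp (- (c / 2) * t\<^sup>2) * exp (c / 4 * t\<^sup>2) = exp (- (c / 4) * t\<^sup>2)"
        by (simp add: exp_add[symmetric] field_simps)
      finally show "norm (gauss_kernel m S \<xi> * (1 + norm \<xi>) ^ k)
        \<le> norm ((1 + norm m) ^ k * B * exp (- (c / 4) * (norm (\<xi> - m))\<^sup>2))"
        using B(1) by (simp add: t_def abs_mult)
    qed
  qed measurable
qed

subsection \<open>Convergence of the posterior\<close>

lemma integrable_product_lborel:
  fixes f :: "'a::euclidean_space \<Rightarrow> real" and h :: "'b::euclidean_space \<Rightarrow> real"
  assumes f: "integrable lborel f" and h: "integrable lborel h"
  shows "integrable lborel (\<lambda>z. f (fst z) * h (snd z))"
proof -
  have [measurable]: "f \<in> borel_measurable borel" "h \<in> borel_measurable borel"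
    using f h by (auto dest: borel_measurable_integrable)
  have "integrable (lborel \<Otimes>\<^sub>M lborel) (\<lambda>z. f (fst z) * h (snd z))"
  proof (rule lborel_pair.Fubini_integrable)
    show "(\<lambda>z. f (fst z) * h (snd z)) \<in> borel_measurable (lborel \<Otimes>\<^sub>M lborel)" by measurable
    show "integrable lborel (\<lambda>x. \<integral>y. norm (f (fst (x, y)) * h (snd (x, y))) \<partial>lborel)"
      using f by (simp add: abs_mult)
    show "AE x in lborel. integrable lborel (\<lambda>y. f (fst (x, y)) * h (snd (x, y)))"
      using h by simp
  qed
  then show ?thesis by (simp add: lborel_prod)
qed

text \<open>
  Applied to the normalising constant of the Gaussian prior, so that the sign of \<open>det S\<close> never
  matters; for \<open>c = 0\<close> the junk value of \<open>0 / 0\<close> makes the posterior vanish.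
\<close>
lemma posterior_scale:
  "posterior (\<lambda>z. c * prior z) f y x g K z = (if c = 0 then 0 else posterior prior f y x g K z)"
proof -
  have "unnorm_post (\<lambda>z. c * prior z) f y x g K = (\<lambda>z. c * unnorm_post prior f y x g K z)"
    by (simp add: unnorm_post_def fun_eq_iff)
  then show ?thesis by (simp add: posterior_def)
qed

context log_regular_density
begin

lemma lik_eq: "lik f y x g \<beta> \<xi> i = poisson_mixture f (y i) (exp (x i \<bullet> \<beta> + g i \<bullet> (\<xi> $ i)))"
  by (simp add: lik_def poisson_mixture_def)

lemma mixture_exp_measurable:
  fixes x :: "'n::finite \<Rightarrow> real^'p" and g :: "'n \<Rightarrow> real^'q"
  shows "(\<lambda>z::(real^'p) \<times> (real^'q^'n). poisson_mixture f k (exp (x i \<bullet> fst z + g i \<bullet> (snd z $ i)))) \<in> borel_measurable borel"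
  by (rule measurable_compose[OF borel_measurable_continuous_onI mixture_measurable])
    (intro continuous_intros)

text \<open>Multiplying by \<open>cc \<omega>\<close> leaves the posterior unchanged. The rescaled
  \<open>V\<close> tends pointwise to \<open>V0\<close> under the integrable bound \<open>w\<close>,
  so the normalising constants converge as well, and \<open>\<kappa> ^ card L\<close> cancels in the
  limit.\<close>

lemma posterior_tendsto:
  fixes x :: "'n::finite \<Rightarrow> real^'p" and g :: "'n \<Rightarrow> real^'q"
    and p :: "real^'p \<Rightarrow> real" and h :: "real^'q^'n \<Rightarrow> real" and K L :: "'n set"
    and y :: "real \<Rightarrow> 'n \<Rightarrow> nat" and yK :: "'n \<Rightarrow> nat"
  assumes \<kappa>: "\<kappa> > 0"
    and p_nonneg: "\<And>b. p b \<ge> 0" and p_int: "integrable lborel p" and p_one: "integral\<^sup>L lborel p \<noteq> 0"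
    and h_pos: "\<And>\<xi>. h \<xi> > 0" and h_int: "\<And>k. integrable lborel (\<lambda>\<xi>. h \<xi> * (1 + norm \<xi>) ^ k)"
    and part: "K \<union> L = UNIV" "K \<inter> L = {}"
    and yK: "\<And>\<omega> i. i \<in> K \<Longrightarrow> y \<omega> i = yK i"
    and yL: "\<And>i. i \<in> L \<Longrightarrow> filterlim (\<lambda>\<omega>. y \<omega> i) at_top at_top"
    and card: "card L + CARD('p) \<le> card {i \<in> K. yK i \<ge> 1} + 1"
    and gp: "\<And>J. J \<subseteq> {i \<in> K. yK i \<ge> 1} \<Longrightarrow> card J = CARD('p) \<Longrightarrow> inj_on x J \<and> independent (x ` J)"
  shows "((\<lambda>\<omega>. posterior (\<lambda>z. p (fst z) * h (snd z)) f (y \<omega>) x g UNIV z0)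
    \<longlongrightarrow> posterior (\<lambda>z. p (fst z) * h (snd z)) f yK x g K z0) at_top"
proof -
  define prior where "prior = (\<lambda>z. p (fst z) * h (snd z))"
  define r where "r z i = x i \<bullet> fst z + g i \<bullet> (snd z $ i)" for z :: "(real^'p) \<times> (real^'q^'n)" and i
  define cn where "cn k = real k * log_weight (ln (real k))" for k
  define PK where "PK z = (\<Prod>i\<in>K. poisson_mixture f (yK i) (exp (r z i)))" for z
  define PL where "PL \<omega> z = (\<Prod>i\<in>L. cn (y \<omega> i) * poisson_mixture f (y \<omega> i) (exp (r z i)))" for \<omega> z
  define V where "V \<omega> z = prior z * PK z * PL \<omega> z" for \<omega> z
  define V0 where "V0 z = prior z * PK z * \<kappa> ^ card L" for z
  define cc where "cc \<omega> = (\<Prod>i\<in>L. cn (y \<omega> i))" for \<omega>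
  define I where "I = {i \<in> K. yK i \<ge> 1}"
  have [measurable]: "p \<in> borel_measurable borel" "h \<in> borel_measurable borel"
    using p_int h_int[of 0] by (auto dest: borel_measurable_integrable)
  have [measurable]: "prior \<in> borel_measurable borel"
    unfolding prior_def borel_prod[symmetric] by measurable
  have [measurable]: "(\<lambda>z. poisson_mixture f k (exp (r z i))) \<in> borel_measurable borel" for k i
    unfolding r_def by (rule mixture_exp_measurable)
  have [measurable]: "PK \<in> borel_measurable borel" "PL \<omega> \<in> borel_measurable borel" for \<omega>
    unfolding PK_def PL_def by measurable
  have prior_nonneg: "prior z \<ge> 0" for z
    using p_nonneg[of "fst z"] h_pos[of "snd z"] by (simp add: prior_def)
  have PK_pos: "PK z > 0" for z
    unfolding PK_def by (intro prod_pos) (simp add: mixture_pos)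

  have unnorm_K: "unnorm_post prior f yK x g K = (\<lambda>z. prior z * PK z)"
    by (simp add: unnorm_post_def lik_eq PK_def r_def fun_eq_iff)
  have unnorm_V: "V \<omega> z = cc \<omega> * unnorm_post prior f (y \<omega>) x g UNIV z" for \<omega> z
  proof -
    have "(\<Prod>i\<in>UNIV. lik f (y \<omega>) x g (fst z) (snd z) i)
        = (\<Prod>i\<in>K. lik f (y \<omega>) x g (fst z) (snd z) i) * (\<Prod>i\<in>L. lik f (y \<omega>) x g (fst z) (snd z) i)"
      unfolding part(1)[symmetric] by (rule prod.union_disjoint) (use part in auto)
    also have "(\<Prod>i\<in>K. lik f (y \<omega>) x g (fst z) (snd z) i) = PK z"
      unfolding PK_def by (intro prod.cong) (auto simp: lik_eq r_def yK)
    finally show ?thesis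
      by (simp add: unnorm_post_def V_def PL_def cc_def prod.distrib lik_eq r_def)
  qed

  obtain A where A: "\<And>k. k \<ge> 1 \<Longrightarrow> A k > 0" "\<And>k b. k \<ge> 1 \<Longrightarrow> b > 0 \<Longrightarrow> poisson_mixture f k b \<le> A k / log_weight (ln b)"
    using mixture_decay by metis
  obtain B where B: "B > 0" "\<And>k b. k \<ge> 2 \<Longrightarrow> b > 0 \<Longrightarrow> cn k * poisson_mixture f k b \<le> B * log_weight (ln b)"
    using scaled_mixture_le unfolding cn_def by metis
  obtain R where R: "R > 0" "\<And>\<beta> (\<xi>::real^'q^'n).
    (\<Prod>i\<in>L. log_weight (x i \<bullet> \<beta> + g i \<bullet> (\<xi> $ i)))
    \<le> R * (1 + norm \<xi>) ^ (3 * card L) * (\<Prod>i\<in>I. log_weight (x i \<bullet> \<beta> + g i \<bullet> (\<xi> $ i)))"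
    using log_weight_prod_ratio[of L I x g] card gp unfolding I_def by blast
  define F where "F = (LBINT u:{0<..}. f u)"
  \<comment> \<open>Positive counts contribute their decay constants; a zero count is bounded only
    by the total mass \<open>F\<close>.\<close>
  define AK where "AK = (\<Prod>i\<in>I. A (yK i)) * (\<Prod>i\<in>K - I. F)"
  define w where "w z = (AK * B ^ card L * R) * (p (fst z) * (h (snd z) * (1 + norm (snd z)) ^ (3 * card L)))" for z
  have F: "F > 0" using mixture_pos[of 1 0] mixture_le[of 1 0] by (simp add: F_def)
  have AK: "AK > 0" unfolding AK_def using F A(1) by (intro mult_pos_pos prod_pos) (auto simp: I_def)
  have PK_le: "PK z \<le> AK / (\<Prod>i\<in>I. log_weight (r z i))" for z
  proof -
    have "PK z = (\<Prod>i\<in>K - I. poisson_mixture f (yK i) (exp (r z i))) * (\<Prod>i\<in>I. poisson_mixture f (yK i) (exp (r z i)))"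
      unfolding PK_def by (rule prod.subset_diff) (auto simp: I_def)
    also have "\<dots> \<le> (\<Prod>i\<in>K - I. F) * (\<Prod>i\<in>I. A (yK i) / log_weight (r z i))"
    proof (intro mult_mono prod_mono conjI prod_nonneg ballI)
      fix i assume "i \<in> K - I"
      show "poisson_mixture f (yK i) (exp (r z i)) \<le> F" unfolding F_def by (rule mixture_le) simp
    next
      fix i assume "i \<in> I"
      then show "poisson_mixture f (yK i) (exp (r z i)) \<le> A (yK i) / log_weight (r z i)"
        using A(2)[of "yK i" "exp (r z i)"] by (simp add: I_def)
    qed (use F in \<open>auto simp: mixture_nonneg\<close>)
    finally show ?thesis by (simp add: AK_def prod_dividef mult.commute)
  qed
  have y_ge2: "eventually (\<lambda>\<omega>. \<forall>i\<in>L. y \<omega> i \<ge> 2) at_top"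
    using yL by (intro eventually_ball_finite) (auto simp: filterlim_at_top)
  have bound: "\<forall>\<^sub>F \<omega> in at_top. AE z in lborel. norm (V \<omega> z) \<le> w z"
    using y_ge2
  proof eventually_elim
    case (elim \<omega>)
    show ?case
    proof (rule AE_I2)
      fix z
      let ?WL = "\<Prod>i\<in>L. log_weight (r z i)" and ?WI = "\<Prod>i\<in>I. log_weight (r z i)"
      have WI: "?WI > 0" by (intro prod_pos log_weight_pos ballI)
      have cn_nonneg: "cn k \<ge> 0" for k unfolding cn_def using log_weight_pos by (simp add: less_imp_le)
      have PL0: "PL \<omega> z \<ge> 0" unfolding PL_def
        by (intro prod_nonneg ballI mult_nonneg_nonneg cn_nonneg mixture_nonneg) simp
      have "PL \<omega> z \<le> (\<Prod>i\<in>L. B * log_weight (r z i))"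
        unfolding PL_def
      proof (intro prod_mono conjI)
        fix i assume "i \<in> L"
        then show "cn (y \<omega> i) * poisson_mixture f (y \<omega> i) (exp (r z i)) \<le> B * log_weight (r z i)"
          using B(2)[of "y \<omega> i" "exp (r z i)"] elim by simp
      qed (auto intro!: mult_nonneg_nonneg cn_nonneg mixture_nonneg)
      also have "\<dots> = B ^ card L * ?WL" by (simp add: prod.distrib)
      also have "\<dots> \<le> B ^ card L * (R * (1 + norm (snd z)) ^ (3 * card L) * ?WI)"
        using R(2)[of "fst z" "snd z"] B(1) unfolding r_def by (intro mult_left_mono) auto
      finally have "PK z * PL \<omega> z \<le> AK / ?WI * (B ^ card L * (R * (1 + norm (snd z)) ^ (3 * card L) * ?WI))"
        using PK_pos[of z] PL0 PK_le[of z] AK WI by (intro mult_mono) auto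
      also have "\<dots> = AK * B ^ card L * R * (1 + norm (snd z)) ^ (3 * card L)"
        using less_imp_neq[OF WI] by (simp add: field_simps del: prod_zero_iff)
      finally have "prior z * (PK z * PL \<omega> z) \<le> prior z * (AK * B ^ card L * R * (1 + norm (snd z)) ^ (3 * card L))"
        using prior_nonneg by (intro mult_left_mono)
      moreover have "norm (V \<omega> z) = prior z * (PK z * PL \<omega> z)"
        using prior_nonneg[of z] PK_pos[of z] PL0 by (simp add: V_def abs_mult)
      ultimately show "norm (V \<omega> z) \<le> w z" by (simp add: w_def prior_def mult_ac)
    qed
  qed
  have w_int: "integrable lborel w"
    unfolding w_def by (intro integrable_mult_right integrable_product_lborel p_int h_int)
  have V_lim: "((\<lambda>\<omega>. V \<omega> z) \<longlongrightarrow> V0 z) at_top" for z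
  proof -
    have "((\<lambda>\<omega>. cn (y \<omega> i) * poisson_mixture f (y \<omega> i) (exp (r z i))) \<longlongrightarrow> \<kappa>) at_top" if "i \<in> L" for i
      using filterlim_compose[OF scaled_mixture_tendsto yL[OF that], of "exp (r z i)"] by (simp add: cn_def)
    then have "((\<lambda>\<omega>. PL \<omega> z) \<longlongrightarrow> (\<Prod>i\<in>L. \<kappa>)) at_top"
      unfolding PL_def by (intro tendsto_prod)
    then show ?thesis unfolding V_def V0_def by (intro tendsto_intros) simp
  qed
  \<comment> \<open>The two placeholders are the measurability conditions for the limit and for the
    family.\<close>
  note dct = _ _ w_int AE_I2[OF V_lim] bound
  have int_lim: "((\<lambda>\<omega>. integral\<^sup>L lborel (V \<omega>)) \<longlongrightarrow> integral\<^sup>L lborel V0) at_top"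
    by (rule integral_dominated_convergence_at_top[OF dct]) (auto simp: V_def[abs_def] V0_def[abs_def])
  have V0_int: "integrable lborel V0"
    by (rule integrable_dominated_convergence_at_top[OF dct]) (auto simp: V_def[abs_def] V0_def[abs_def])
  have V0_ne: "integral\<^sup>L lborel V0 \<noteq> 0"
  proof
    assume "integral\<^sup>L lborel V0 = 0"
    then have "AE z in lborel. V0 z = 0"
      using \<kappa> prior_nonneg PK_pos
      by (subst (asm) integral_nonneg_eq_0_iff_AE[OF V0_int]) (auto simp: V0_def less_imp_le)
    \<comment> \<open>All other factors of \<open>V0\<close> are positive, so \<open>p\<close> would
      vanish almost everywhere and could not have a nonzero integral.\<close>
    moreover have "p (fst z) = 0" if "V0 z = 0" for z
      using that \<kappa> PK_pos[of z] h_pos[of "snd z"] by (simp add: V0_def prior_def)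
    ultimately have "AE z in (lborel :: ((real^'p) \<times> (real^'q^'n)) measure). p (fst z) = 0"
      by (rule eventually_mono)
    then have "AE z in lborel \<Otimes>\<^sub>M (lborel :: (real^'q^'n) measure). p (fst z) = 0"
      by (simp only: lborel_prod)
    then have "AE b in lborel. AE \<xi> in (lborel :: (real^'q^'n) measure). p b = 0"
      by (auto dest: lborel_pair.AE_pair)
    \<comment> \<open>The inner statement is constant in \<open>\<xi>\<close>, and Lebesgue measure
      is not the zero measure.\<close>
    then have "AE b in lborel. p b = 0"
      by (simp add: eventually_const ae_filter_eq_bot_iff)
    then have "integral\<^sup>L lborel p = 0" by (rule integral_eq_zero_AE)
    with p_one show False by contradiction
  qed
  have "((\<lambda>\<omega>. V \<omega> z0 / integral\<^sup>L lborel (V \<omega>)) \<longlongrightarrow> V0 z0 / integral\<^sup>L lborel V0) at_top"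
    by (intro tendsto_divide V_lim int_lim V0_ne)
  also have "V0 z0 / integral\<^sup>L lborel V0 = posterior prior f yK x g K z0"
    using \<kappa> by (simp add: posterior_def unnorm_K V0_def[abs_def])
  finally have "((\<lambda>\<omega>. V \<omega> z0 / integral\<^sup>L lborel (V \<omega>)) \<longlongrightarrow> posterior prior f yK x g K z0) at_top" .
  then show ?thesis
    unfolding prior_def[symmetric]
  proof (rule Lim_transform_eventually)
    show "\<forall>\<^sub>F \<omega> in at_top. V \<omega> z0 / integral\<^sup>L lborel (V \<omega>) = posterior prior f (y \<omega>) x g UNIV z0"
      using y_ge2
    proof eventually_elim
      case (elim \<omega>)
      have "cc \<omega> > 0" unfolding cc_def cn_def
        using elim by (intro prod_pos ballI mult_pos_pos log_weight_pos) force
      then show ?case by (simp add: posterior_def unnorm_V[abs_def])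
    qed
  qed
qed

end

theorem theorem3:
  fixes s \<alpha> :: real
    and x :: "'n::finite \<Rightarrow> real^'p"
    and g :: "'n \<Rightarrow> real^'q"
    and \<pi>\<beta> :: "real^'p \<Rightarrow> real"
    and m :: "real^'q^'n" and S :: "real^('n \<times> 'q)^('n \<times> 'q)"
    and K L :: "'n set"
    and y :: "real \<Rightarrow> 'n \<Rightarrow> nat" and yK :: "'n \<Rightarrow> nat"
    and \<beta> :: "real^'p" and \<xi> :: "real^'q^'n"
  assumes s: "0 < s" "s < 1"
    and \<alpha>: "\<alpha> \<ge> 1"
    and \<pi>\<beta>_meas: "\<pi>\<beta> \<in> borel_measurable borel"
    and \<pi>\<beta>_nonneg: "\<And>b. \<pi>\<beta> b \<ge> 0"
    and \<pi>\<beta>_int: "integrable lborel \<pi>\<beta>"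
    and \<pi>\<beta>_one: "integral\<^sup>L lborel \<pi>\<beta> = 1"
    and S_pd: "pos_def_matrix S"
    and part: "K \<union> L = UNIV" "K \<inter> L = {}" "K \<noteq> {}" "L \<noteq> {}"
    and yK_fixed: "\<And>\<omega> i. i \<in> K \<Longrightarrow> y \<omega> i = yK i"
    and yL_inf: "\<And>i. i \<in> L \<Longrightarrow> filterlim (\<lambda>\<omega>. y \<omega> i) at_top at_top"
    and card_cond: "card {i \<in> K. yK i \<ge> 1} + 1 \<ge> card L + CARD('p)"
    and indep: "\<And>J. J \<subseteq> {i \<in> K. yK i \<ge> 1} \<Longrightarrow> card J = CARD('p) \<Longrightarrow>
                     inj_on x J \<and> independent (x ` J)"
  shows "((\<lambda>\<omega>. posterior (\<lambda>z. \<pi>\<beta> (fst z) * mvn_dens (flatten m) S (flatten (snd z)))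
                        (mix_dens s \<alpha>) (y \<omega>) x g UNIV (\<beta>, \<xi>))
          \<longlongrightarrow> posterior (\<lambda>z. \<pi>\<beta> (fst z) * mvn_dens (flatten m) S (flatten (snd z)))
                        (mix_dens s \<alpha>) yK x g K (\<beta>, \<xi>)) at_top"
proof -
  obtain C where "log_regular_density (mix_dens s \<alpha>) (s / pi) C"
    using mix_dens_log_regular[OF s \<alpha>] by blast
  then interpret log_regular_density "mix_dens s \<alpha>" "s / pi" C .
  define Z where "Z = 1 / sqrt ((2 * pi) ^ CARD('n \<times> 'q) * det S)"
  have prior: "(\<lambda>z. \<pi>\<beta> (fst z) * mvn_dens (flatten m) S (flatten (snd z)))
      = (\<lambda>z. Z * (\<pi>\<beta> (fst z) * gauss_kernel m S (snd z)))"
    by (simp add: mvn_dens_flatten Z_def fun_eq_iff)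
  have "((\<lambda>\<omega>. posterior (\<lambda>z. \<pi>\<beta> (fst z) * gauss_kernel m S (snd z)) (mix_dens s \<alpha>) (y \<omega>) x g UNIV (\<beta>, \<xi>))
      \<longlongrightarrow> posterior (\<lambda>z. \<pi>\<beta> (fst z) * gauss_kernel m S (snd z)) (mix_dens s \<alpha>) yK x g K (\<beta>, \<xi>)) at_top"
    by (rule posterior_tendsto[OF _ \<pi>\<beta>_nonneg \<pi>\<beta>_int _ gauss_kernel_pos
          gauss_kernel_moment_integrable[OF S_pd] part(1,2) yK_fixed yL_inf card_cond indep])
      (use s \<pi>\<beta>_one in auto)
  then show ?thesis unfolding prior posterior_scale by simp
qed

end
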